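(* Let $g$ be a non-negative real-valued multiplicative function such that: (a) $g$ is uniformly bounded on the primes, i.e. $g(p)\le \beta$ for some constant $\beta$ and all primes $p$; (b) the series $\sum q^{-1} g(q)$, taken over the prime-powers $q=p^k$ with $k\ge 2$, converges; (c) the sums $y^{-1}\sum_{q\le y} g(q)\log q$, where $q$ runs over all prime-powers, are uniformly bounded for $y\ge 2$. Let $h$ be a complex-valued multiplicative function satisfying $|h(n)|\le g(n)$ for all $n\ge1$. Set $G(x)=\sum_{n\le x} n^{-1}g(n)$ and $H(x)=\sum_{n\le x} n^{-1}h(n)$ for $x\ge 1$. Then, as $x\to\infty$, \[ H(x) = \left( \prod_{p\le x} \left(1+\frac{h(p)}{p}+\frac{h(p^2)}{p^2}+\cdots\right)\left(1+\frac{g(p)}{p}+\frac{g(p^2)}{p^2}+\cdots\right)^{-1} + o(1)\right) G(x). \]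
   Context: Multiplicative means $f(mn)=f(m)f(n)$ whenever $\gcd(m,n)=1$, with $f(1)=1$. The product is over primes $p\le x$. *)

theory Defs
  imports "HOL-Analysis.Analysis" "HOL-Number_Theory.Prime_Powers"
begin

definition multiplicative :: "(nat \<Rightarrow> 'a :: comm_semiring_1) \<Rightarrow> bool" where
  "multiplicative f \<longleftrightarrow> f 1 = 1 \<and> (\<forall>m n. coprime m n \<longrightarrow> f (m * n) = f m * f n)"

end

theory Submission
  imports Defs
begin

text \<open>
  Write \<open>F\<^sub>f(\<sigma>) = \<Sum> f(n) n\<^bsup>-1-\<sigma>\<^esup>\<close>, \<open>L = log x\<close>, and let \<open>P(x)\<close> be the product in the theorem.
  The Euler products give \<open>F\<^sub>h(\<lambda>/L) = (P(x) + o(1)) F\<^sub>g(\<lambda>/L)\<close> for each fixed \<open>\<lambda> > 0\<close>. If \<open>P(x) \<rightarrow> 0\<close>,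
  this follows from finitely many factors, as every factor of \<open>F\<^sub>h/F\<^sub>g\<close> has modulus at most 1.
  Otherwise \<open>\<Sum> (g(p) - Re h(p))/p\<close> converges, and together with
  \<open>|g(p) - h(p)|\<^sup>2 \<le> 2 g(p) (g(p) - Re h(p))\<close> and condition (c) this shows that the truncation at
  \<open>p \<le> x\<close> and the factors \<open>p\<^bsup>-\<sigma>\<^esup>\<close> change the product by \<open>o(1)\<close> only.

  Karamata's method transfers this to the partial sums: approximating the function that is \<open>1/u\<close>
  for \<open>u \<ge> 1/e\<close> and 0 elsewhere by polynomials in \<open>u = n\<^bsup>-1/L\<^esup>\<close> expresses \<open>H(x)\<close> and \<open>G(x)\<close> through the
  values \<open>F(k/L)\<close>. The jump at \<open>1/e\<close> is harmless because condition (c) bounds the sum of \<open>g(n)/n\<close> over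
  \<open>x < n \<le> x\<^bsup>1+\<epsilon>\<^esup>\<close> by \<open>O((\<epsilon> + 1/L) F\<^sub>g(1/L))\<close>, and \<open>F\<^sub>g(1/L) = O(G(x))\<close> because halving the argument
  increases \<open>F\<^sub>g\<close> by a bounded factor only.
\<close>

subsection \<open>Euler products\<close>

definition primes_upto :: "nat \<Rightarrow> nat set" where
  "primes_upto N = {p. prime p \<and> p \<le> N}"

lemma finite_primes_upto [simp]: "finite (primes_upto N)"
  by (rule finite_subset[of _ "{..N}"]) (auto simp: primes_upto_def)

text \<open>Positivity is required separately because \<open>prime_factors 0\<close> is empty, which
  would make 0 smooth for every set.\<close>

definition smooth_nats :: "nat set \<Rightarrow> nat set" where
  "smooth_nats A = {n. n > 0 \<and> prime_factors n \<subseteq> A}"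

lemma smooth_nats_empty: "smooth_nats {} = {1}"
  by (auto simp: smooth_nats_def prime_factorization_empty_iff set_mset_eq_empty_iff)

lemma coprime_prime_power_smooth:
  assumes "prime p" "p \<notin> A" "m \<in> smooth_nats A"
  shows "coprime (p ^ k) m"
proof -
  have "\<not> p dvd m"
    using assms by (auto simp: smooth_nats_def in_prime_factors_iff subset_iff)
  thus ?thesis using assms(1) by (simp add: prime_imp_coprime coprime_power_left_iff)
qed

text \<open>Unique factorization: each number splits in exactly one way into a power of
  \<open>p\<close> and a part prime to \<open>p\<close>. This is what adding one prime to a finite
  Euler product amounts to.\<close>

lemma bij_betw_smooth_nats_insert:
  assumes "prime p" "p \<notin> A"
  shows "bij_betw (\<lambda>(k, m). p ^ k * m) (UNIV \<times> smooth_nats A) (smooth_nats (insert p A))"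
  unfolding bij_betw_def
proof
  have mult: "multiplicity p (p ^ k * m) = k" if "m \<in> smooth_nats A" for k m
  proof -
    have "\<not> p dvd m" "m \<noteq> 0"
      using assms that by (auto simp: smooth_nats_def in_prime_factors_iff subset_iff)
    thus ?thesis using assms(1)
      by (intro multiplicity_eqI) (auto simp: mult.commute power_Suc2 prime_gt_0_nat simp del: power_Suc)
  qed
  show "inj_on (\<lambda>(k, m). p ^ k * m) (UNIV \<times> smooth_nats A)"
  proof (intro inj_onI, clarify)
    fix k m k' m' assume "m \<in> smooth_nats A" "m' \<in> smooth_nats A" and eq: "p ^ k * m = p ^ k' * m'"
    hence "k = k'" by (metis mult)
    thus "k = k' \<and> m = m'" using eq assms(1) by auto
  qed
  show "(\<lambda>(k, m). p ^ k * m) ` (UNIV \<times> smooth_nats A) = smooth_nats (insert p A)" (is "?f ` ?S = ?T")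
  proof
    have "p ^ k * m \<in> ?T" if m: "m \<in> smooth_nats A" for k m
    proof -
      have "q \<in> insert p A" if "prime q" "q dvd p ^ k * m" for q
        using that m assms(1) prime_dvd_power_nat[of q p k] primes_dvd_imp_eq[of q p]
        by (auto simp: prime_dvd_mult_iff smooth_nats_def in_prime_factors_iff)
      thus ?thesis using m assms(1) by (auto simp: smooth_nats_def in_prime_factors_iff prime_gt_0_nat)
    qed
    thus "?f ` ?S \<subseteq> ?T" by auto
    show "?T \<subseteq> ?f ` ?S"
    proof
      fix n assume n: "n \<in> ?T"
      hence "n \<noteq> 0" by (simp add: smooth_nats_def)
      moreover have "\<not> is_unit p" using assms(1) by auto
      ultimately obtain m where m: "n = p ^ multiplicity p n * m" "\<not> p dvd m"
        by (rule multiplicity_decompose')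
      have "m > 0" using m \<open>n \<noteq> 0\<close> by (cases m) auto
      moreover have "prime_factors m \<subseteq> prime_factors n"
        using m(1) \<open>n \<noteq> 0\<close> by (metis dvd_prime_factors dvd_triv_right)
      ultimately have "m \<in> smooth_nats A"
        using n m(2) by (auto simp: smooth_nats_def)
      thus "n \<in> ?f ` ?S" using m(1) by (intro image_eqI[of _ _ "(multiplicity p n, m)"]) auto
    qed
  qed
qed

lemma multiplicative_coprime: "multiplicative f \<Longrightarrow> coprime m n \<Longrightarrow> f (m * n) = f m * f n"
  by (simp add: multiplicative_def)

lemma multiplicative_1: "multiplicative f \<Longrightarrow> f (Suc 0) = 1"
  by (simp add: multiplicative_def)

text \<open>Absolute summability of both families gives it on the rectangle, so the double sum may
  be evaluated row by row. The second conclusion feeds the induction over primes.\<close>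

lemma has_sum_product_abs:
  fixes f :: "'a \<Rightarrow> 'c :: {real_normed_field, banach}" and g :: "'b \<Rightarrow> 'c"
  assumes f: "(f has_sum s) A" "(\<lambda>x. norm (f x)) summable_on A" and g: "(g has_sum t) B" "(\<lambda>y. norm (g y)) summable_on B"
  shows "((\<lambda>(x, y). f x * g y) has_sum (s * t)) (A \<times> B)"
    and "(\<lambda>z. norm (case z of (x, y) \<Rightarrow> f x * g y)) summable_on (A \<times> B)"
proof -
  show abs: "(\<lambda>z. norm (case z of (x, y) \<Rightarrow> f x * g y)) summable_on (A \<times> B)"
    unfolding Infinite_Sum.abs_summable_on_Sigma_iff
  proof (intro conjI ballI)
    show "(\<lambda>y. norm (case (x, y) of (x, y) \<Rightarrow> f x * g y)) summable_on B" for x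
      using g(2) by (auto simp: norm_mult intro: summable_on_cmult_right)
    have "(\<Sum>\<^sub>\<infinity>y\<in>B. norm (f x * g y)) = norm (f x) * (\<Sum>\<^sub>\<infinity>y\<in>B. norm (g y))" for x
      using g(2) by (simp add: norm_mult infsum_cmult_right)
    thus "(\<lambda>x. norm (\<Sum>\<^sub>\<infinity>y\<in>B. norm (case (x, y) of (x, y) \<Rightarrow> f x * g y))) summable_on A"
      using f(2) by (auto simp: abs_mult intro: summable_on_cmult_left)
  qed
  show "((\<lambda>(x, y). f x * g y) has_sum (s * t)) (A \<times> B)"
  proof (rule has_sum_SigmaI)
    show "((\<lambda>y. case (x, y) of (x, y) \<Rightarrow> f x * g y) has_sum (f x * t)) B" for x
      using g(1) by (auto intro: has_sum_cmult_right)
    show "((\<lambda>x. f x * t) has_sum (s * t)) A"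
      using f(1) by (rule has_sum_cmult_left)
    show "(\<lambda>(x, y). f x * g y) summable_on A \<times> B"
      using abs abs_summable_summable by blast
  qed
qed

text \<open>Induction on the set of primes: the bijection for \<open>insert p A\<close> and
  multiplicativity turn the new sum into a product of two sums. Absolute summability is carried
  along because the product step demands it.\<close>

lemma has_sum_smooth_nats:
  fixes f :: "nat \<Rightarrow> 'a :: {real_normed_field, banach}"
  assumes "multiplicative f" "finite A" "\<And>p. p \<in> A \<Longrightarrow> prime p"
    and "\<And>p. p \<in> A \<Longrightarrow> summable (\<lambda>k. norm (f (p ^ k)))"
  shows "(f has_sum (\<Prod>p\<in>A. \<Sum>k. f (p ^ k))) (smooth_nats A) \<and> (\<lambda>n. norm (f n)) summable_on smooth_nats A"
  using assms(2,3,4)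
proof (induction A rule: finite_induct)
  case empty
  have "(f has_sum f 1) {1}" using has_sum_finite[of "{1}" f] by simp
  thus ?case using assms(1) by (simp add: smooth_nats_empty multiplicative_1)
next
  case (insert p A)
  have p: "prime p" "p \<notin> A" using insert by auto
  let ?F = "\<lambda>k. f (p ^ k)"
  have "summable (\<lambda>k. norm (?F k))" using insert.prems by auto
  hence F: "(?F has_sum (\<Sum>k. ?F k)) UNIV" "(\<lambda>k. norm (?F k)) summable_on UNIV"
    by (auto intro!: norm_summable_imp_has_sum summable_sums summable_norm_cancel
        simp: summable_on_UNIV_nonneg_real_iff)
  have IH: "(f has_sum (\<Prod>p\<in>A. \<Sum>k. f (p ^ k))) (smooth_nats A)" "(\<lambda>n. norm (f n)) summable_on smooth_nats A"
    using insert.IH insert.prems by auto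
  note bij = bij_betw_smooth_nats_insert[OF p]
  have eq: "f (p ^ k * m) = ?F k * f m" if "m \<in> smooth_nats A" for k m
    by (rule multiplicative_coprime[OF assms(1) coprime_prime_power_smooth[OF p that]])
  have "(f has_sum ((\<Sum>k. ?F k) * (\<Prod>p\<in>A. \<Sum>k. f (p ^ k)))) (smooth_nats (insert p A))"
    unfolding has_sum_reindex_bij_betw[OF bij, symmetric]
    using has_sum_product_abs(1)[OF F IH]
    by (rule has_sum_cong[THEN iffD1, rotated]) (auto simp: eq)
  moreover have "(\<lambda>n. norm (f n)) summable_on smooth_nats (insert p A)"
    unfolding summable_on_reindex_bij_betw[OF bij, symmetric]
    using has_sum_product_abs(2)[OF F IH]
    by (rule summable_on_cong[THEN iffD1, rotated]) (auto simp: eq)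
  ultimately show ?case using insert by simp
qed

lemma atLeastAtMost_subset_smooth_nats: "{1..N} \<subseteq> smooth_nats (primes_upto N)"
proof
  fix n assume n: "n \<in> {1..N}"
  have "p \<le> N" if "p dvd n" for p using n dvd_imp_le[OF that] by simp
  thus "n \<in> smooth_nats (primes_upto N)"
    using n by (auto simp: smooth_nats_def primes_upto_def)
qed

text \<open>All \<open>n \<le> N\<close> are smooth over the primes up to \<open>N\<close>, and the
  other smooth numbers contribute non-negative terms. Only the local series have to converge, so
  this can be used to prove convergence of the full series.\<close>

lemma sum_le_euler_product:
  fixes f :: "nat \<Rightarrow> real"
  assumes "multiplicative f" "\<And>n. f n \<ge> 0" "\<And>p. prime p \<Longrightarrow> summable (\<lambda>k. f (p ^ k))"
  shows "(\<Sum>n=1..N. f n) \<le> (\<Prod>p\<in>primes_upto N. \<Sum>k. f (p ^ k))"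
proof -
  have "(f has_sum (\<Prod>p\<in>primes_upto N. \<Sum>k. f (p ^ k))) (smooth_nats (primes_upto N))"
    using has_sum_smooth_nats[OF assms(1) finite_primes_upto, of N] assms
    by (auto simp: primes_upto_def)
  with has_sum_finite[of "{1..N}" f, OF finite_atLeastAtMost] show ?thesis
    by (rule has_sum_mono_neutral) (use assms(2) atLeastAtMost_subset_smooth_nats[of N] in auto)
qed

lemma summable_norm_prime_powers:
  fixes f :: "nat \<Rightarrow> 'a :: real_normed_vector"
  assumes "summable (\<lambda>n. norm (f n))" "prime p"
  shows "summable (\<lambda>k. norm (f (p ^ k)))"
proof -
  have "inj (\<lambda>k. p ^ k)" using prime_gt_1_nat[OF assms(2)] by (auto simp: inj_def)
  from summable_reindex[OF assms(1) this] show ?thesis by (simp add: o_def)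
qed

text \<open>A number that is not smooth over the primes up to \<open>N\<close> is 0 or exceeds
  \<open>N\<close>, so the error is at most a tail of the absolutely convergent series;
  \<open>f 0 = 0\<close> removes the exceptional number.\<close>

lemma euler_product_tendsto:
  fixes f :: "nat \<Rightarrow> 'a :: {real_normed_field, banach}"
  assumes mult: "multiplicative f" and f0: "f 0 = 0" and summ: "summable (\<lambda>n. norm (f n))"
  shows "(\<lambda>N. \<Prod>p\<in>primes_upto N. \<Sum>k. f (p ^ k)) \<longlonglongrightarrow> (\<Sum>n. f n)"
proof -
  have bound: "norm ((\<Prod>p\<in>primes_upto N. \<Sum>k. f (p ^ k)) - (\<Sum>n. f n)) \<le> (\<Sum>n. norm (f (n + Suc N)))" for N
  proof -
    let ?S = "smooth_nats (primes_upto N)"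
    have tot: "(f has_sum (\<Sum>n. f n)) UNIV"
      by (intro norm_summable_imp_has_sum summ summable_sums summable_norm_cancel[OF summ])
    have abs: "(\<lambda>n. norm (f n)) summable_on B" for B
      using summ summable_on_subset_banach[of "\<lambda>n. norm (f n)" UNIV B] by (auto simp: summable_on_UNIV_nonneg_real_iff)
    have "(f has_sum (\<Prod>p\<in>primes_upto N. \<Sum>k. f (p ^ k))) ?S"
      using has_sum_smooth_nats[OF mult finite_primes_upto, of N] summable_norm_prime_powers[OF summ]
      by (auto simp: primes_upto_def)
    hence diff: "(f has_sum ((\<Sum>n. f n) - (\<Prod>p\<in>primes_upto N. \<Sum>k. f (p ^ k)))) (UNIV - ?S)"
      using tot by (intro has_sum_Diff) auto
    have "norm ((\<Sum>n. f n) - (\<Prod>p\<in>primes_upto N. \<Sum>k. f (p ^ k))) \<le> infsum (\<lambda>n. norm (f n)) (UNIV - ?S)"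
      using norm_infsum_bound[OF abs, of "UNIV - ?S"] infsumI[OF diff] by simp
    also have "\<dots> \<le> infsum (\<lambda>n. norm (f n)) ((\<lambda>n. n + Suc N) ` UNIV)"
    proof (rule infsum_mono_neutral[OF abs abs])
      fix n assume n: "n \<in> UNIV - ?S - range (\<lambda>n. n + Suc N)"
      have "n = 0"
      proof (rule ccontr)
        assume "n \<noteq> 0"
        hence "n \<notin> {1..N} \<longrightarrow> n = (n - Suc N) + Suc N" by auto
        thus False using n atLeastAtMost_subset_smooth_nats[of N] by blast
      qed
      thus "norm (f n) \<le> 0" using f0 by simp
    qed auto
    also have "\<dots> = infsum (\<lambda>n. norm (f (n + Suc N))) UNIV"
      by (subst infsum_reindex) (auto simp: o_def inj_on_def)
    also have "\<dots> = (\<Sum>n. norm (f (n + Suc N)))"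
    proof -
      have "summable (\<lambda>n. norm (f (n + Suc N)))" using summ by (rule summable_ignore_initial_segment)
      thus ?thesis
        by (intro infsumI norm_summable_imp_has_sum summable_sums) auto
    qed
    finally show ?thesis by (simp add: norm_minus_commute)
  qed
  have "(\<lambda>N. \<Sum>n. norm (f (n + Suc N))) \<longlonglongrightarrow> 0"
    using LIMSEQ_Suc[OF suminf_exist_split2[OF summ]] by simp
  hence "(\<lambda>N. (\<Prod>p\<in>primes_upto N. \<Sum>k. f (p ^ k)) - (\<Sum>n. f n)) \<longlonglongrightarrow> 0"
    by (rule Lim_null_comparison[OF always_eventually[OF allI[OF bound]]])
  thus ?thesis by (rule LIM_zero_cancel)
qed

subsection \<open>The dominating function\<close>

text \<open>The terms of the series F_f from the introduction; \<open>efac\<close> is its factor at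
  \<open>p\<close> and \<open>dser\<close> its sum. At \<sigma> = 0, \<open>efac\<close> is the
  local factor occurring in the theorem. Division by zero makes the term at 0 vanish.\<close>

definition dterm :: "(nat \<Rightarrow> 'a :: real_normed_field) \<Rightarrow> real \<Rightarrow> nat \<Rightarrow> 'a" where
  "dterm f \<sigma> n = f n / of_nat n * of_real (real n powr (- \<sigma>))"

definition efac :: "(nat \<Rightarrow> 'a :: real_normed_field) \<Rightarrow> real \<Rightarrow> nat \<Rightarrow> 'a" where
  "efac f \<sigma> p = (\<Sum>k. dterm f \<sigma> (p ^ k))"

definition dser :: "(nat \<Rightarrow> 'a :: real_normed_field) \<Rightarrow> real \<Rightarrow> 'a" where
  "dser f \<sigma> = (\<Sum>n. dterm f \<sigma> n)"

lemma dterm_0 [simp]: "dterm f \<sigma> 0 = 0"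
  by (simp add: dterm_def)

lemma dterm_zero_exponent: "dterm f 0 n = f n / of_nat n"
  by (cases "n = 0") (auto simp: dterm_def)

lemma multiplicative_dterm: "multiplicative f \<Longrightarrow> multiplicative (dterm f \<sigma>)"
  by (auto simp: multiplicative_def dterm_def powr_mult)

text \<open>Dyadic decomposition of the range from \<open>y\<close> to \<open>2 ^ J * y\<close>. The
  block bound is assumed for all finite subsets of a block, so that the induction can peel off the
  top block of an arbitrary \<open>Q\<close>.\<close>

lemma sum_of_blocks_le:
  fixes w :: "nat \<Rightarrow> real"
  assumes "y > 0"
    and w: "\<And>j Q. finite Q \<Longrightarrow> (\<And>q. q \<in> Q \<Longrightarrow> q \<in> S \<and> 2 ^ j * y < real q \<and> real q \<le> 2 * (2 ^ j * y)) \<Longrightarrow> (\<Sum>q\<in>Q. w q) \<le> b j"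
    and "finite Q" "\<And>q. q \<in> Q \<Longrightarrow> q \<in> S \<and> y < real q \<and> real q \<le> 2 ^ J * y"
  shows "(\<Sum>q\<in>Q. w q) \<le> (\<Sum>j<J. b j)"
  using assms(3,4)
proof (induction J arbitrary: Q)
  case 0
  hence "Q = {}" by force
  thus ?case by simp
next
  case (Suc J)
  let ?A = "{q \<in> Q. real q \<le> 2 ^ J * y}" and ?B = "{q \<in> Q. \<not> real q \<le> 2 ^ J * y}"
  have "(\<Sum>q\<in>Q. w q) = (\<Sum>q\<in>?A. w q) + (\<Sum>q\<in>?B. w q)"
    using Suc.prems(1) by (subst sum.union_disjoint[symmetric]) (auto intro: sum.cong)
  also have "\<dots> \<le> (\<Sum>j<J. b j) + b J"
    using Suc.prems by (intro add_mono Suc.IH w) (auto simp: mult.assoc)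
  finally show ?case by simp
qed

section \<open>Sums over prime powers\<close>

locale chebyshev_mult =
  fixes g :: "nat \<Rightarrow> real" and \<beta> C :: real
  assumes g_mult: "multiplicative g"
    and g_nonneg: "g n \<ge> 0"
    and g_prime_le: "prime p \<Longrightarrow> g p \<le> \<beta>"
    and g_higher: "(\<lambda>q. g q / real q) summable_on {q. \<exists>p k. prime p \<and> k \<ge> 2 \<and> q = p ^ k}"
    and g_cheb: "y \<ge> 2 \<Longrightarrow> (\<Sum>q | primepow q \<and> real q \<le> y. g q * ln (real q)) \<le> C * y"
begin

lemma C_nonneg: "C \<ge> 0"
proof -
  have "0 \<le> (\<Sum>q | primepow q \<and> real q \<le> 2. g q * ln (real q))"
    by (intro sum_nonneg mult_nonneg_nonneg g_nonneg) (auto dest: primepow_gt_0_nat)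
  also have "\<dots> \<le> C * 2" by (rule g_cheb) auto
  finally show ?thesis by simp
qed

lemma \<beta>_nonneg: "\<beta> \<ge> 0"
  using g_nonneg[of 2] g_prime_le[of 2] by simp

text \<open>On a dyadic block \<open>1 / q\<close> is below \<open>1 / y\<close>, and condition (c)
  at \<open>2 * y\<close> bounds the rest; \<open>y \<ge> 1\<close> puts \<open>2 * y\<close> into
  the range of that condition.\<close>

lemma pp_block:
  assumes "finite Q" "\<And>q. q \<in> Q \<Longrightarrow> primepow q \<and> y < real q \<and> real q \<le> 2 * y" "y \<ge> 1"
  shows "(\<Sum>q\<in>Q. g q * ln (real q) / real q) \<le> 2 * C"
proof -
  have "(\<Sum>q\<in>Q. g q * ln (real q) / real q) \<le> (\<Sum>q\<in>Q. g q * ln (real q) / y)"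
    using assms(2,3) g_nonneg
    by (intro sum_mono divide_left_mono mult_nonneg_nonneg mult_pos_pos) (force dest: primepow_gt_0_nat)+
  also have "\<dots> = (\<Sum>q\<in>Q. g q * ln (real q)) / y" by (simp add: sum_divide_distrib)
  also have "(\<Sum>q\<in>Q. g q * ln (real q)) \<le> (\<Sum>q | primepow q \<and> real q \<le> 2 * y. g q * ln (real q))"
  proof (rule sum_mono2)
    show "finite {q. primepow q \<and> real q \<le> 2 * y}"
      by (rule finite_subset[of _ "{..nat \<lfloor>2 * y\<rfloor>}"]) (auto simp: le_nat_iff le_floor_iff)
    show "0 \<le> g q * ln (real q)" if "q \<in> {q. primepow q \<and> real q \<le> 2 * y} - Q" for q
      using that g_nonneg[of q] by (auto dest: primepow_gt_0_nat)
  qed (use assms in auto)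
  also have "\<dots> \<le> C * (2 * y)" using assms by (intro g_cheb) auto
  finally show ?thesis using assms(3) by (simp add: divide_right_mono field_simps)
qed

lemma pp_window:
  assumes "finite Q" "\<And>q. q \<in> Q \<Longrightarrow> primepow q \<and> y < real q \<and> real q \<le> 2 ^ J * y" "y \<ge> 1"
  shows "(\<Sum>q\<in>Q. g q * ln (real q) / real q) \<le> 2 * C * real J"
proof -
  have "(\<Sum>q\<in>Q. g q * ln (real q) / real q) \<le> (\<Sum>j<J. 2 * C)"
  proof (rule sum_of_blocks_le[where S = "{q. primepow q}" and y = y])
    fix j :: nat and Q' :: "nat set" assume "finite Q'"
      "\<And>q. q \<in> Q' \<Longrightarrow> q \<in> {q. primepow q} \<and> 2 ^ j * y < real q \<and> real q \<le> 2 * (2 ^ j * y)"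
    thus "(\<Sum>q\<in>Q'. g q * ln (real q) / real q) \<le> 2 * C"
      using assms(3) mult_mono[of 1 "2 ^ j" 1 y] by (intro pp_block[of _ "2 ^ j * y"]) auto
  qed (use assms in auto)
  thus ?thesis by (simp add: mult_ac)
qed

text \<open>In the block above \<open>2 ^ j\<close> the factor \<open>q powr (- \<sigma>)\<close> is
  at most \<open>r ^ j\<close> with \<open>r = 2 powr (- \<sigma>)\<close>. Each block costs
  \<open>2 * C\<close>, and the geometric series contributes at most
  \<open>4 / \<sigma>\<close>.\<close>

lemma pp_dirichlet:
  assumes "finite Q" "\<And>q. q \<in> Q \<Longrightarrow> primepow q" "0 < \<sigma>" "\<sigma> \<le> 1"
  shows "(\<Sum>q\<in>Q. g q * ln (real q) / real q * real q powr (- \<sigma>)) \<le> 8 * C / \<sigma>"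
proof -
  define r where "r = (2::real) powr (- \<sigma>)"
  have ln2: "ln (2::real) \<ge> 1 / 2" "ln (2::real) \<le> 1"
    using ln_2_less_1 ln_one_minus_pos_upper_bound[of "1/2"] by (auto simp: ln_div)
  \<comment> \<open>From exp t \<ge> 1 + t and ln 2 \<ge> 1/2 one gets r \<le> 1 / (1 + \<sigma>/2);
    the last estimate uses \<sigma> \<le> 1.\<close>
  have r: "1 - r \<ge> \<sigma> / 4" "r \<ge> 0"
  proof -
    have "r = 1 / exp (\<sigma> * ln 2)" by (simp add: r_def powr_def exp_minus field_simps)
    also have "\<dots> \<le> 1 / (1 + \<sigma> * ln 2)"
      using assms(3) ln2 by (intro divide_left_mono exp_ge_add_one_self mult_pos_pos add_pos_nonneg) auto
    also have "\<dots> \<le> 1 / (1 + \<sigma> / 2)"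
      using assms(3) ln2 by (intro divide_left_mono) (auto intro!: mult_pos_pos add_pos_nonneg simp: field_simps)
    also have "\<dots> \<le> 1 - \<sigma> / 4"
    proof -
      have "(1 - \<sigma> / 4) * (1 + \<sigma> / 2) = 1 + \<sigma> * (2 - \<sigma>) / 8" by (simp add: field_simps)
      also have "\<dots> \<ge> 1" using assms by simp
      finally show ?thesis using assms by (simp add: field_simps)
    qed
    finally show "1 - r \<ge> \<sigma> / 4" by simp
  qed (simp add: r_def)
  obtain J where J: "\<And>q. q \<in> Q \<Longrightarrow> real q \<le> 2 ^ J * 1"
  proof -
    obtain J where "real (Max (insert 0 Q)) < 2 ^ J"
      using real_arch_pow[of 2 "real (Max (insert 0 Q))"] by auto
    moreover have "real q \<le> real (Max (insert 0 Q))" if "q \<in> Q" for q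
      using that assms(1) by auto
    ultimately show ?thesis by (intro that[of J]) force
  qed
  have "(\<Sum>q\<in>Q. g q * ln (real q) / real q * real q powr (- \<sigma>)) \<le> (\<Sum>j<J. 2 * C * r ^ j)"
  proof (rule sum_of_blocks_le[where S = "{q. primepow q}" and y = 1])
    fix j :: nat and Q' :: "nat set" assume Q': "finite Q'"
      "\<And>q. q \<in> Q' \<Longrightarrow> q \<in> {q. primepow q} \<and> 2 ^ j * 1 < real q \<and> real q \<le> 2 * (2 ^ j * 1)"
    have "(\<Sum>q\<in>Q'. g q * ln (real q) / real q * real q powr (- \<sigma>)) \<le>
          (\<Sum>q\<in>Q'. g q * ln (real q) / real q * r ^ j)"
    proof (intro sum_mono mult_left_mono)
      fix q assume q: "q \<in> Q'"
      have "r ^ j = (2 ^ j) powr (- \<sigma>)"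
        by (simp add: r_def powr_powr powr_realpow[symmetric] mult_ac powr_power)
      thus "real q powr (- \<sigma>) \<le> r ^ j"
        using Q'(2)[OF q] assms(3) by (auto intro!: powr_mono2')
      show "0 \<le> g q * ln (real q) / real q"
        using Q'(2)[OF q] g_nonneg[of q] by (auto dest: primepow_gt_0_nat)
    qed
    also have "\<dots> = (\<Sum>q\<in>Q'. g q * ln (real q) / real q) * r ^ j" by (simp add: sum_distrib_right)
    also have "\<dots> \<le> 2 * C * r ^ j"
      using Q' r by (intro mult_right_mono pp_block[of _ "2 ^ j"]) auto
    finally show "(\<Sum>q\<in>Q'. g q * ln (real q) / real q * real q powr (- \<sigma>)) \<le> 2 * C * r ^ j" .
  qed (use assms J in \<open>auto dest: primepow_gt_Suc_0\<close>)
  also have "\<dots> = 2 * C * (\<Sum>j<J. r ^ j)" by (simp add: sum_distrib_left)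
  also have "(\<Sum>j<J. r ^ j) \<le> 4 / \<sigma>"
  proof -
    have "r \<noteq> 1" using r assms by auto
    hence "(\<Sum>j<J. r ^ j) = (1 - r ^ J) / (1 - r)" by (simp add: sum_gp_strict)
    also have "\<dots> \<le> 1 / (\<sigma> / 4)" using r assms by (intro frac_le) auto
    finally show ?thesis by simp
  qed
  hence "2 * C * (\<Sum>j<J. r ^ j) \<le> 2 * C * (4 / \<sigma>)" using C_nonneg by (intro mult_left_mono) auto
  finally show ?thesis by simp
qed

section \<open>Prime powers with exponent at least 2\<close>

lemma summable_higher: 
  assumes "prime p"
  shows "summable (\<lambda>k. dterm g 0 (p ^ (k + 2)))"
proof -
  have "inj_on (\<lambda>k. p ^ (k + 2)) UNIV" using prime_gt_1_nat[OF assms] by (auto simp: inj_def)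
  moreover have "(\<lambda>q. g q / real q) summable_on range (\<lambda>k. p ^ (k + 2))"
  proof (rule summable_on_subset_banach[OF g_higher], clarify)
    show "\<exists>p' k'. prime p' \<and> 2 \<le> k' \<and> p ^ (k + 2) = p' ^ k'" for k
      using assms by (intro exI[of _ p] exI[of _ "k + 2"]) simp
  qed
  ultimately have "(\<lambda>k. g (p ^ (k + 2)) / real (p ^ (k + 2))) summable_on UNIV"
    by (subst (asm) summable_on_reindex) (auto simp: o_def)
  thus ?thesis unfolding dterm_zero_exponent
    by (auto dest: summable_on_imp_summable)
qed

text \<open>The part of the local factor of \<open>g\<close> at \<sigma> = 0 coming from exponents
  at least 2. It is 0 off the primes so that condition (b) becomes summability of a plain
  sequence.\<close>

definition htail :: "nat \<Rightarrow> real" where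
  "htail p = (if prime p then \<Sum>k. dterm g 0 (p ^ (k + 2)) else 0)"

lemma dterm_g_nonneg: "dterm g \<sigma> n \<ge> 0"
  using g_nonneg by (simp add: dterm_def)

lemma htail_nonneg: "htail p \<ge> 0"
  by (auto simp: htail_def intro!: suminf_nonneg summable_higher dterm_g_nonneg simp del: power_Suc add_2_eq_Suc')

text \<open>Condition (b) sums over a set of numbers; since \<open>(p, k)\<close> is determined by
  \<open>p ^ (k + 2)\<close>, that sum can be regrouped by the prime \<open>p\<close>.\<close>

lemma summable_htail: "summable htail"
proof -
  let ?F = "\<lambda>(p, k). p ^ (k + 2) :: nat"
  have inj: "inj_on ?F ({p. prime p} \<times> UNIV)"
    by (auto simp: inj_on_def prime_power_inj'' simp del: power_Suc add_2_eq_Suc')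
  have "?F ` ({p. prime p} \<times> UNIV) = {q::nat. \<exists>p k. prime p \<and> k \<ge> 2 \<and> q = p ^ k}"
  proof (intro equalityI subsetI)
    fix q assume "q \<in> {q::nat. \<exists>p k. prime p \<and> k \<ge> 2 \<and> q = p ^ k}"
    then obtain p k where "prime p" "k \<ge> 2" "q = p ^ k" by auto
    hence "q = ?F (p, k - 2)" "(p, k - 2) \<in> {p. prime p} \<times> UNIV" by (auto simp del: power_Suc add_2_eq_Suc')
    thus "q \<in> ?F ` ({p. prime p} \<times> UNIV)" by blast
  next
    fix q assume "q \<in> ?F ` ({p. prime p} \<times> UNIV)"
    then obtain p k where "prime p" "q = p ^ (k + 2)"
      by (auto simp del: power_Suc add_2_eq_Suc')
    thus "q \<in> {q::nat. \<exists>p k. prime p \<and> k \<ge> 2 \<and> q = p ^ k}"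
      by (intro CollectI exI[of _ p] exI[of _ "k + 2"]) simp
  qed
  hence "((\<lambda>q. dterm g 0 q) \<circ> ?F) summable_on ({p. prime p} \<times> UNIV)"
    using g_higher summable_on_reindex[OF inj, of "dterm g 0"] by (simp add: dterm_zero_exponent[abs_def])
  hence "(\<lambda>p. infsum (\<lambda>k. ((\<lambda>q. dterm g 0 q) \<circ> ?F) (p, k)) UNIV) summable_on {p. prime p}"
    by (intro summable_on_Sigma_banach) (simp add: case_prod_unfold o_def)
  also have "?this \<longleftrightarrow> htail summable_on {p. prime p}"
  proof (rule summable_on_cong)
    fix p :: nat assume p: "p \<in> {p. prime p}"
    have "infsum (\<lambda>k. dterm g 0 (p ^ (k + 2))) UNIV = (\<Sum>k. dterm g 0 (p ^ (k + 2)))"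
      using summable_higher[of p] p dterm_g_nonneg
      by (intro infsumI norm_summable_imp_has_sum summable_sums) (auto simp del: power_Suc add_2_eq_Suc')
    thus "infsum (\<lambda>k. ((\<lambda>q. dterm g 0 q) \<circ> ?F) (p, k)) UNIV = htail p"
      using p by (simp add: htail_def del: power_Suc add_2_eq_Suc')
  qed
  also have "\<dots> \<longleftrightarrow> htail summable_on UNIV"
    by (rule summable_on_cong_neutral) (auto simp: htail_def)
  finally show ?thesis using htail_nonneg by (simp add: summable_on_UNIV_nonneg_real_iff)
qed

section \<open>Local factors and series of functions dominated by \<open>g\<close>\<close>

definition dominated :: "(nat \<Rightarrow> 'a :: real_normed_field) \<Rightarrow> bool" where
  "dominated f \<longleftrightarrow> multiplicative f \<and> (\<forall>n\<ge>1. norm (f n) \<le> g n)"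

lemma dominated_g: "dominated g"
  using g_mult g_nonneg by (simp add: dominated_def)

lemma norm_dterm_le:
  assumes "dominated f" "\<sigma> \<ge> \<tau>"
  shows "norm (dterm f \<sigma> n) \<le> dterm g \<tau> n"
proof (cases "n = 0")
  case False
  have "norm (f n) / real n * real n powr (- \<sigma>) \<le> g n / real n * real n powr (- \<tau>)"
    using assms False g_nonneg by (intro mult_mono divide_right_mono powr_mono) (auto simp: dominated_def)
  thus ?thesis by (simp add: dterm_def norm_mult norm_divide)
qed auto

lemma summable_dterm_g_prime_powers:
  assumes "prime p" "\<sigma> \<ge> 0"
  shows "summable (\<lambda>k. dterm g \<sigma> (p ^ k))"
proof -
  have "summable (\<lambda>k. dterm g 0 (p ^ k))"
    using summable_higher[OF assms(1)] by (subst (asm) summable_iff_shift)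
  thus ?thesis
    using norm_dterm_le[OF dominated_g assms(2)] by (rule summable_comparison_test'[where N = 0])
qed

lemma summable_norm_dterm_prime_powers:
  assumes "dominated f" "prime p" "\<sigma> \<ge> 0"
  shows "summable (\<lambda>k. norm (dterm f \<sigma> (p ^ k)))"
  by (rule summable_comparison_test'[OF summable_dterm_g_prime_powers[OF assms(2,3)], where N = 0])
    (use norm_dterm_le[OF assms(1) order.refl] in auto)

text \<open>The exponents 0 and 1 give the two subtracted terms, and the others are majorized by
  \<open>g\<close> at \<sigma> = 0. The bound is thus uniform in \<sigma> and summable over the
  primes.\<close>

lemma norm_efac_tail_le:
  fixes f :: "nat \<Rightarrow> 'a :: {real_normed_field, banach}"
  assumes "dominated f" "prime p" "\<sigma> \<ge> 0"
  shows "norm (efac f \<sigma> p - 1 - dterm f \<sigma> p) \<le> htail p"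
proof -
  let ?a = "\<lambda>k. dterm f \<sigma> (p ^ k)"
  have sn: "summable (\<lambda>k. norm (?a k))" by (rule summable_norm_dterm_prime_powers[OF assms])
  have s: "summable ?a" using sn by (rule summable_norm_cancel)
  have "?a 0 = 1" using assms(1) by (simp add: dominated_def dterm_def multiplicative_1)
  hence "efac f \<sigma> p - 1 - dterm f \<sigma> p = (\<Sum>k. ?a (k + 2))"
    using suminf_split_initial_segment[OF s, of 2] unfolding efac_def
    by (simp add: numeral_2_eq_2)
  also have "norm \<dots> \<le> (\<Sum>k. norm (?a (k + 2)))"
    using sn by (intro summable_norm) (subst summable_iff_shift)
  also have "\<dots> \<le> (\<Sum>k. dterm g 0 (p ^ (k + 2)))"
    using norm_dterm_le[OF assms(1,3)] sn
    by (intro suminf_le summable_higher[OF assms(2)]) (assumption, subst summable_iff_shift)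
  also have "\<dots> = htail p" using assms(2) by (simp add: htail_def)
  finally show ?thesis .
qed

lemma efac_g_ge: 
  assumes "prime p" "\<sigma> \<ge> 0"
  shows "efac g \<sigma> p \<ge> 1"
proof -
  have "(\<Sum>k\<in>{0}. dterm g \<sigma> (p ^ k)) \<le> efac g \<sigma> p"
    unfolding efac_def by (intro sum_le_suminf summable_dterm_g_prime_powers assms dterm_g_nonneg) auto
  thus ?thesis using g_mult by (simp add: dterm_def multiplicative_1)
qed

lemma norm_efac_le:
  fixes f :: "nat \<Rightarrow> 'a :: {real_normed_field, banach}"
  assumes "dominated f" "prime p" "\<sigma> \<ge> 0"
  shows "norm (efac f \<sigma> p) \<le> efac g \<sigma> p"
proof -
  have "norm (efac f \<sigma> p) \<le> (\<Sum>k. norm (dterm f \<sigma> (p ^ k)))"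
    unfolding efac_def by (rule summable_norm[OF summable_norm_dterm_prime_powers[OF assms]])
  also have "\<dots> \<le> efac g \<sigma> p" unfolding efac_def
    by (intro suminf_le norm_dterm_le summable_norm_dterm_prime_powers summable_dterm_g_prime_powers assms order.refl)
  finally show ?thesis .
qed

text \<open>The finite Euler product bounds the partial sums. Each factor is at most the exponential
  of its linear term plus \<open>htail p\<close>; inserting \<open>2 * ln p \<ge> 1\<close> lets
  \<open>pp_dirichlet\<close> bound the sum of the linear terms.\<close>

lemma summable_dterm_g:
  assumes "\<sigma> > 0"
  shows "summable (dterm g \<sigma>)"
proof -
  \<comment> \<open>\<open>pp_dirichlet\<close> requires an exponent of at most 1; larger exponents
    follow by comparison.\<close>
  define \<tau> where "\<tau> = min \<sigma> 1"
  have \<tau>: "\<tau> > 0" "\<tau> \<le> 1" "\<tau> \<le> \<sigma>" using assms by (auto simp: \<tau>_def)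
  have "summable (dterm g \<tau>)"
  proof (rule summableI_nonneg_bounded[OF dterm_g_nonneg])
    fix N
    have "(\<Sum>n<N. dterm g \<tau> n) \<le> (\<Sum>n=0..N. dterm g \<tau> n)"
      using dterm_g_nonneg by (intro sum_mono2) auto
    also have "\<dots> = (\<Sum>n=1..N. dterm g \<tau> n)" by (simp add: sum.atLeast_Suc_atMost)
    also have "\<dots> \<le> (\<Prod>p\<in>primes_upto N. efac g \<tau> p)"
      unfolding efac_def using \<tau>
      by (intro sum_le_euler_product multiplicative_dterm g_mult dterm_g_nonneg summable_dterm_g_prime_powers) auto
    also have "\<dots> \<le> (\<Prod>p\<in>primes_upto N. exp (dterm g \<tau> p + htail p))"
    proof (rule prod_mono)
      fix p assume "p \<in> primes_upto N"
      hence p: "prime p" by (simp add: primes_upto_def)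
      have "efac g \<tau> p \<le> 1 + (dterm g \<tau> p + htail p)"
        using norm_efac_tail_le[OF dominated_g p, of \<tau>] \<tau> by (auto simp: abs_le_iff)
      thus "0 \<le> efac g \<tau> p \<and> efac g \<tau> p \<le> exp (dterm g \<tau> p + htail p)"
        using efac_g_ge[OF p, of \<tau>] \<tau> exp_ge_add_one_self[of "dterm g \<tau> p + htail p"] by linarith
    qed
    also have "\<dots> = exp ((\<Sum>p\<in>primes_upto N. dterm g \<tau> p) + (\<Sum>p\<in>primes_upto N. htail p))"
      by (simp add: exp_sum sum.distrib[symmetric])
    also have "\<dots> \<le> exp (2 * (8 * C / \<tau>) + suminf htail)"
    proof -
      have "(\<Sum>p\<in>primes_upto N. htail p) \<le> suminf htail"
        by (intro sum_le_suminf summable_htail htail_nonneg) auto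
      moreover have "(\<Sum>p\<in>primes_upto N. dterm g \<tau> p) \<le> (\<Sum>p\<in>primes_upto N. 2 * (g p * ln (real p) / real p * real p powr (- \<tau>)))"
      proof (rule sum_mono)
        fix p assume "p \<in> primes_upto N"
        hence "prime p" by (simp add: primes_upto_def)
        hence "ln (real p) \<ge> ln 2" by (auto dest: prime_ge_2_nat)
        hence "ln (real p) \<ge> 1 / 2"
          using ln_one_minus_pos_upper_bound[of "1/2"] by (simp add: ln_div)
        hence "dterm g \<tau> p * 1 \<le> dterm g \<tau> p * (2 * ln (real p))"
          using dterm_g_nonneg by (intro mult_left_mono) auto
        thus "dterm g \<tau> p \<le> 2 * (g p * ln (real p) / real p * real p powr (- \<tau>))"
          by (simp add: dterm_def mult_ac)
      qed
      moreover have "\<dots> \<le> 2 * (8 * C / \<tau>)"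
        unfolding sum_distrib_left[symmetric]
        by (intro mult_left_mono pp_dirichlet \<tau>) (auto simp: primes_upto_def)
      ultimately show ?thesis by simp
    qed
    finally show "(\<Sum>n<N. dterm g \<tau> n) \<le> exp (2 * (8 * C / \<tau>) + suminf htail)" .
  qed
  thus ?thesis using norm_dterm_le[OF dominated_g \<tau>(3)] by (rule summable_comparison_test'[where N = 0])
qed

lemma summable_norm_dterm:
  assumes "dominated f" "\<sigma> > 0"
  shows "summable (\<lambda>n. norm (dterm f \<sigma> n))"
  by (rule summable_comparison_test'[OF summable_dterm_g[OF assms(2)], where N = 0])
    (use norm_dterm_le[OF assms(1) order.refl] in auto)

lemma dser_euler:
  fixes f :: "nat \<Rightarrow> 'a :: {real_normed_field, banach}"
  assumes "dominated f" "\<sigma> > 0"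
  shows "(\<lambda>N. \<Prod>p\<in>primes_upto N. efac f \<sigma> p) \<longlonglongrightarrow> dser f \<sigma>"
  unfolding efac_def dser_def
  by (rule euler_product_tendsto)
     (use assms summable_norm_dterm in \<open>auto intro!: multiplicative_dterm simp: dominated_def\<close>)

lemma dser_g_mono: "0 < \<tau> \<Longrightarrow> \<tau> \<le> \<sigma> \<Longrightarrow> dser g \<sigma> \<le> dser g \<tau>"
  unfolding dser_def using norm_dterm_le[OF dominated_g, of \<tau> \<sigma>] dterm_g_nonneg[of \<sigma>]
  by (intro suminf_le summable_dterm_g) auto

lemma dser_g_ge: "\<sigma> > 0 \<Longrightarrow> dser g \<sigma> \<ge> 1"
proof -
  assume "\<sigma> > 0"
  hence "(\<Sum>n\<in>{1}. dterm g \<sigma> n) \<le> dser g \<sigma>"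
    unfolding dser_def by (intro sum_le_suminf summable_dterm_g dterm_g_nonneg) auto
  thus ?thesis using g_mult by (simp add: dterm_def multiplicative_1)
qed

text \<open>Factor out n^(-\<sigma>/2) and use 1 - exp (-t) \<le> t.\<close>

lemma dterm_half_diff_le:
  assumes "\<sigma> > 0" "n > 0"
  shows "dterm g (\<sigma> / 2) n - dterm g \<sigma> n \<le> \<sigma> / 2 * (g n * ln (real n) / real n * real n powr (- (\<sigma> / 2)))"
proof -
  have "real n powr (- \<sigma>) = real n powr (- (\<sigma> / 2)) * real n powr (- (\<sigma> / 2))"
    by (simp add: powr_add[symmetric])
  moreover have "1 - real n powr (- (\<sigma> / 2)) \<le> \<sigma> / 2 * ln (real n)"
    using exp_ge_add_one_self[of "- (\<sigma> / 2) * ln (real n)"] assms by (simp add: powr_def)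
  hence "g n / real n * real n powr (- (\<sigma> / 2)) * (1 - real n powr (- (\<sigma> / 2))) \<le>
         g n / real n * real n powr (- (\<sigma> / 2)) * (\<sigma> / 2 * ln (real n))"
    using g_nonneg by (intro mult_left_mono) auto
  ultimately show ?thesis by (simp add: dterm_def algebra_simps diff_divide_distrib)
qed

text \<open>Factorwise comparison of Euler products: a \<le> b exp (a - b) whenever a \<ge> b \<ge>
  1, so it suffices to bound the sum of all a - b. That is a sum over prime powers, where the factor
  \<sigma>/2 from \<open>dterm_half_diff_le\<close> cancels the pole in \<open>pp_dirichlet\<close>;
  hence the constant does not depend on \<sigma>.\<close>

lemma dser_g_half:
  assumes "0 < \<sigma>" "\<sigma> \<le> 1"
  shows "dser g (\<sigma> / 2) \<le> exp (8 * C) * dser g \<sigma>"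
proof (rule LIMSEQ_le)
  show "(\<lambda>N. \<Prod>p\<in>primes_upto N. efac g (\<sigma> / 2) p) \<longlonglongrightarrow> dser g (\<sigma> / 2)"
    using assms by (intro dser_euler dominated_g) auto
  show "(\<lambda>N. exp (8 * C) * (\<Prod>p\<in>primes_upto N. efac g \<sigma> p)) \<longlonglongrightarrow> exp (8 * C) * dser g \<sigma>"
    using assms by (intro tendsto_intros dser_euler dominated_g) auto
  have "(\<Prod>p\<in>primes_upto N. efac g (\<sigma> / 2) p) \<le> exp (8 * C) * (\<Prod>p\<in>primes_upto N. efac g \<sigma> p)" for N
  proof -
    let ?P = "primes_upto N"
    let ?d = "\<lambda>k p. dterm g (\<sigma> / 2) (p ^ k) - dterm g \<sigma> (p ^ k)"
    have P: "prime p" if "p \<in> ?P" for p using that by (simp add: primes_upto_def)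
    have summ: "summable (\<lambda>k. ?d k p)" if "p \<in> ?P" for p
      using P[OF that] assms by (intro summable_diff summable_dterm_g_prime_powers) auto
    have "(\<Sum>p\<in>?P. efac g (\<sigma> / 2) p - efac g \<sigma> p) = (\<Sum>p\<in>?P. \<Sum>k. ?d k p)"
      unfolding efac_def using P assms
      by (intro sum.cong suminf_diff summable_dterm_g_prime_powers) auto
    also have "\<dots> = (\<Sum>k. \<Sum>p\<in>?P. ?d k p)"
      using summ by (subst suminf_sum) auto
    also have "\<dots> \<le> 8 * C"
    proof (rule suminf_le_const)
      show "summable (\<lambda>k. \<Sum>p\<in>?P. ?d k p)" using summ by (rule summable_sum)
      fix K
      let ?w = "\<lambda>q. \<sigma> / 2 * (g q * ln (real q) / real q * real q powr (- (\<sigma> / 2)))"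
      \<comment> \<open>The terms with \<open>k = 0\<close> cancel. Without them the numbers
        \<open>p ^ k\<close> are prime powers and determine \<open>(k, p)\<close>.\<close>
      have "(\<Sum>k<K. \<Sum>p\<in>?P. ?d k p) = (\<Sum>k\<in>{1..<K}. \<Sum>p\<in>?P. ?d k p)"
        by (rule sum.mono_neutral_right) (auto simp: dterm_def not_less_eq_eq)
      also have "\<dots> \<le> (\<Sum>k\<in>{1..<K}. \<Sum>p\<in>?P. ?w (p ^ k))"
        using assms P by (intro sum_mono dterm_half_diff_le) (auto simp: prime_gt_0_nat)
      also have "\<dots> = (\<Sum>(k, p)\<in>{1..<K} \<times> ?P. ?w (p ^ k))"
        by (simp add: sum.cartesian_product)
      also have "\<dots> = (\<Sum>q\<in>(\<lambda>(k, p). p ^ k) ` ({1..<K} \<times> ?P). ?w q)"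
      proof (subst sum.reindex)
        show "inj_on (\<lambda>(k, p). p ^ k) ({1..<K} \<times> ?P)"
          by (auto simp: inj_on_def primes_upto_def prime_power_inj'')
      qed (simp add: o_def case_prod_unfold)
      also have "\<dots> \<le> \<sigma> / 2 * (8 * C / (\<sigma> / 2))"
        unfolding sum_distrib_left[symmetric] using assms P
        by (intro mult_left_mono pp_dirichlet) auto
      also have "\<dots> = 8 * C" using assms by simp
      finally show "(\<Sum>k<K. \<Sum>p\<in>?P. ?d k p) \<le> 8 * C" .
    qed
    finally have le: "(\<Sum>p\<in>?P. efac g (\<sigma> / 2) p - efac g \<sigma> p) \<le> 8 * C" .
    have "(\<Prod>p\<in>?P. efac g (\<sigma> / 2) p) \<le> (\<Prod>p\<in>?P. efac g \<sigma> p * exp (efac g (\<sigma> / 2) p - efac g \<sigma> p))"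
    proof (rule prod_mono)
      fix p assume p: "p \<in> ?P"
      let ?a = "efac g (\<sigma> / 2) p" and ?b = "efac g \<sigma> p"
      have b: "?b \<ge> 1" "?a \<ge> 1" using efac_g_ge[OF P[OF p]] assms by auto
      have ab: "?b \<le> ?a" unfolding efac_def using P[OF p] assms norm_dterm_le[OF dominated_g, of "\<sigma> / 2" \<sigma>] dterm_g_nonneg[of \<sigma>]
        by (intro suminf_le summable_dterm_g_prime_powers) auto
      have "?a \<le> ?b + ?b * (?a - ?b)" using mult_right_mono[of 1 ?b "?a - ?b"] ab b by simp
      also have "\<dots> = ?b * (1 + (?a - ?b))" by (simp add: algebra_simps)
      also have "\<dots> \<le> ?b * exp (?a - ?b)" using b by (intro mult_left_mono exp_ge_add_one_self) auto
      finally show "0 \<le> ?a \<and> ?a \<le> ?b * exp (?a - ?b)" using b by simp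
    qed
    also have "\<dots> = exp (\<Sum>p\<in>?P. efac g (\<sigma> / 2) p - efac g \<sigma> p) * (\<Prod>p\<in>?P. efac g \<sigma> p)"
      by (simp add: prod.distrib exp_sum)
    also have "\<dots> \<le> exp (8 * C) * (\<Prod>p\<in>?P. efac g \<sigma> p)"
    proof (intro mult_right_mono prod_nonneg ballI)
      show "0 \<le> efac g \<sigma> p" if "p \<in> ?P" for p
        using efac_g_ge[OF P[OF that], of \<sigma>] assms by simp
    qed (use le in simp)
    finally show ?thesis .
  qed
  thus "\<exists>N. \<forall>n\<ge>N. (\<Prod>p\<in>primes_upto n. efac g (\<sigma> / 2) p) \<le> exp (8 * C) * (\<Prod>p\<in>primes_upto n. efac g \<sigma> p)"
    by blast
qed

end

subsection \<open>Logarithmic sums of the dominating function\<close>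

lemma finite_nats_le [simp]: "finite {n::nat. P n \<and> real n \<le> x}"
  by (rule finite_subset[of _ "{..nat \<lfloor>x\<rfloor>}"]) (auto simp: le_nat_iff le_floor_iff)

text \<open>Covers both sums of the theorem: G for \<open>f = g\<close> and H for
  \<open>f = h\<close>.\<close>

definition log_sum :: "(nat \<Rightarrow> 'a :: real_normed_field) \<Rightarrow> real \<Rightarrow> 'a" where
  "log_sum f x = (\<Sum>n | 1 \<le> n \<and> real n \<le> x. f n / of_nat n)"

lemma ln_eq_sum_prime_factors:
  assumes "n > 0"
  shows "ln (real n) = (\<Sum>p\<in>prime_factors n. ln (real (p ^ multiplicity p n)))"
proof -
  have "real n = (\<Prod>p\<in>prime_factors n. real (p ^ multiplicity p n))"
    using prime_factorization_nat[OF assms] by (metis of_nat_prod)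
  also have "ln \<dots> = (\<Sum>p\<in>prime_factors n. ln (real (p ^ multiplicity p n)))"
    by (rule ln_prod) (auto simp: in_prime_factors_iff prime_gt_0_nat)
  finally show ?thesis .
qed

section \<open>Bounding F_g by G, and short sums of g(n)/n\<close>

context chebyshev_mult
begin

lemma dser_g_half_iterate:
  assumes "0 < \<sigma>" "\<sigma> \<le> 1"
  shows "dser g (\<sigma> / 2 ^ a) \<le> exp (8 * C) ^ a * dser g \<sigma>"
proof (induction a)
  case (Suc a)
  have "\<sigma> / 2 ^ a \<le> 1" using assms by (simp add: divide_le_eq order.trans[OF _ one_le_power])
  hence "dser g (\<sigma> / 2 ^ a / 2) \<le> exp (8 * C) * dser g (\<sigma> / 2 ^ a)"
    using assms by (intro dser_g_half) auto
  also have "\<dots> \<le> exp (8 * C) * (exp (8 * C) ^ a * dser g \<sigma>)"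
    by (intro mult_left_mono Suc) auto
  finally show ?case by (simp add: mult_ac)
qed auto

text \<open>Rankin's trick: beyond \<open>x\<close>, half of the exponent is spent on
  n^(-\<sigma>/2) \<le> x^(-\<sigma>/2), and the other half keeps the series convergent.\<close>

lemma dser_g_tail:
  assumes "\<sigma> > 0" "x > 0"
  shows "dser g \<sigma> \<le> log_sum g x + x powr (- \<sigma> / 2) * dser g (\<sigma> / 2)"
proof -
  let ?S = "{n. 1 \<le> n \<and> real n \<le> x}"
  let ?b = "\<lambda>n. (if n \<in> ?S then g n / real n else 0) + x powr (- \<sigma> / 2) * dterm g (\<sigma> / 2) n"
  have fin: "finite ?S" by simp
  have sums: "?b sums (log_sum g x + x powr (- \<sigma> / 2) * dser g (\<sigma> / 2))"
    unfolding log_sum_def dser_def of_nat_id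
    by (intro sums_add sums_mult sums_If_finite_set fin summable_sums summable_dterm_g) (use assms in auto)
  have "dterm g \<sigma> n \<le> ?b n" for n
  proof (cases "n = 0")
    case False
    show ?thesis
    proof (cases "real n \<le> x")
      case True
      have "g n / real n * real n powr (- \<sigma>) \<le> g n / real n * 1"
        using False assms g_nonneg by (intro mult_left_mono) (auto intro!: powr_le1 simp: powr_minus_divide divide_le_eq ge_one_powr_ge_zero)
      moreover have "x powr (- \<sigma> / 2) * dterm g (\<sigma> / 2) n \<ge> 0"
        using dterm_g_nonneg by simp
      ultimately show ?thesis using True False by (simp add: dterm_def)
    next
      case nx: False
      have "real n powr (- \<sigma>) = real n powr (- \<sigma> / 2) * real n powr (- \<sigma> / 2)"
        by (simp add: powr_add[symmetric])
      also have "\<dots> \<le> x powr (- \<sigma> / 2) * real n powr (- \<sigma> / 2)"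
        using assms nx by (intro mult_right_mono powr_mono2') auto
      finally have "g n / real n * real n powr (- \<sigma>) \<le> g n / real n * (x powr (- \<sigma> / 2) * real n powr (- \<sigma> / 2))"
        using g_nonneg by (intro mult_left_mono) auto
      thus ?thesis using nx by (simp add: dterm_def mult_ac)
    qed
  qed auto
  thus ?thesis
    using sums_le[OF _ summable_sums[OF summable_dterm_g] sums] assms unfolding dser_def by blast
qed

text \<open>For \<sigma> a large multiple of 1 / ln x, the tail in \<open>dser_g_tail\<close> is at
  most half of F_g(\<sigma>) and can be absorbed. Boundedly many halvings then lead back from
  \<sigma> to 1 / ln x at the cost of a constant.\<close>

lemma log_sum_g_lower:
  obtains c where "c > 0" "\<forall>\<^sub>F x in at_top. c * dser g (1 / ln x) \<le> log_sum g x"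
proof -
  \<comment> \<open>Since \<open>2 ^ a \<ge> a\<close>, the choice \<sigma> = 2^a / ln x gives
    x^(-\<sigma>/2) \<le> exp (-8 C - 1). This outweighs the factor exp (8 C) lost in one halving
    and leaves 1/e \<le> 1/2.\<close>
  obtain a :: nat where a: "16 * C + 2 \<le> real a" using real_arch_simple by blast
  let ?c = "1 / (2 * exp (8 * C) ^ a)"
  have "?c * dser g (1 / ln x) \<le> log_sum g x" if x: "x \<ge> exp (2 ^ a)" for x
  proof -
    have pos: "x > 0" using x exp_gt_zero[of "2 ^ a :: real"] by linarith
    have L: "ln x \<ge> 2 ^ a" using x pos by (simp add: ln_ge_iff)
    hence L0: "ln x > 0" by (meson less_le_trans zero_less_numeral zero_less_power)
    define \<sigma> where "\<sigma> = 2 ^ a / ln x"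
    have \<sigma>: "0 < \<sigma>" "\<sigma> \<le> 1" using L L0 by (auto simp: \<sigma>_def)
    have "x powr (- \<sigma> / 2) = exp (- (2 ^ a) / 2)" using pos L0 by (simp add: powr_def \<sigma>_def)
    also have "\<dots> \<le> exp (- 8 * C - 1)"
    proof -
      have "16 * C + 2 \<le> 2 ^ a"
        by (rule order.trans[OF a less_imp_le[OF of_nat_less_two_power]])
      thus ?thesis by simp
    qed
    finally have xp: "x powr (- \<sigma> / 2) \<le> exp (- 8 * C - 1)" .
    have "dser g \<sigma> \<le> log_sum g x + x powr (- \<sigma> / 2) * dser g (\<sigma> / 2)"
      using \<sigma> pos by (intro dser_g_tail) auto
    also have "x powr (- \<sigma> / 2) * dser g (\<sigma> / 2) \<le> exp (- 8 * C - 1) * (exp (8 * C) * dser g \<sigma>)"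
      using dser_g_ge[of "\<sigma> / 2"] \<sigma> by (intro mult_mono xp dser_g_half) auto
    also have "\<dots> = exp (- 1) * dser g \<sigma>" by (simp add: mult.assoc[symmetric] exp_add[symmetric])
    also have "\<dots> \<le> 1 / 2 * dser g \<sigma>"
      using dser_g_ge[OF \<sigma>(1)] exp_ge_add_one_self[of 1] by (intro mult_right_mono) (auto simp: exp_minus field_simps)
    finally have "dser g \<sigma> \<le> 2 * log_sum g x" by simp
    moreover have "dser g (1 / ln x) \<le> exp (8 * C) ^ a * dser g \<sigma>"
      using dser_g_half_iterate[OF \<sigma>, of a] L0 by (simp add: \<sigma>_def)
    ultimately have "dser g (1 / ln x) \<le> exp (8 * C) ^ a * (2 * log_sum g x)"
      by (meson exp_ge_zero mult_left_mono order_trans zero_le_power)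
    thus ?thesis by (simp add: field_simps)
  qed
  hence "\<forall>\<^sub>F x in at_top. ?c * dser g (1 / ln x) \<le> log_sum g x"
    using eventually_ge_at_top by (rule eventually_mono[rotated])
  moreover have "?c > 0" by simp
  ultimately show ?thesis using that by blast
qed

text \<open>Rankin's bound: (z/n)^\<sigma> \<ge> 1 for all n \<le> z.\<close>

lemma log_sum_g_le_dser:
  assumes "\<sigma> > 0" "z \<ge> 1"
  shows "log_sum g z \<le> z powr \<sigma> * dser g \<sigma>"
proof -
  have "log_sum g z \<le> (\<Sum>n | 1 \<le> n \<and> real n \<le> z. z powr \<sigma> * dterm g \<sigma> n)"
    unfolding log_sum_def
  proof (rule sum_mono)
    fix n assume n: "n \<in> {n. 1 \<le> n \<and> real n \<le> z}"
    have "1 = real n powr \<sigma> * real n powr (- \<sigma>)" using n by (simp add: powr_add[symmetric])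
    also have "\<dots> \<le> z powr \<sigma> * real n powr (- \<sigma>)"
      using n assms by (intro mult_right_mono powr_mono2) auto
    finally have "g n / real n * 1 \<le> g n / real n * (z powr \<sigma> * real n powr (- \<sigma>))"
      using g_nonneg by (intro mult_left_mono) auto
    thus "g n / of_nat n \<le> z powr \<sigma> * dterm g \<sigma> n" by (simp add: dterm_def mult_ac)
  qed
  also have "\<dots> = z powr \<sigma> * (\<Sum>n | 1 \<le> n \<and> real n \<le> z. dterm g \<sigma> n)"
    by (simp add: sum_distrib_left)
  also have "\<dots> \<le> z powr \<sigma> * dser g \<sigma>"
    unfolding dser_def using assms
    by (intro mult_left_mono sum_le_suminf summable_dterm_g dterm_g_nonneg) auto
  finally show ?thesis .
qed

text \<open>Expand ln n over the exact prime powers q of n and write n = m q with m and q coprime,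
  so that g(n) = g(m) g(q). For each m the sum over q is bounded by \<open>W\<close>, and the
  remaining sum over m is at most G(z).\<close>

lemma log_weighted_sum_le:
  assumes "finite I" "0 \<notin> I" "\<And>n. n \<in> I \<Longrightarrow> real n \<le> z"
    and W: "\<And>m Q. m \<ge> 1 \<Longrightarrow> finite Q \<Longrightarrow> (\<And>q. q \<in> Q \<Longrightarrow> primepow q \<and> m * q \<in> I) \<Longrightarrow>
              (\<Sum>q\<in>Q. g q * ln (real q) / real q) \<le> B"
  shows "(\<Sum>n\<in>I. g n * ln (real n) / real n) \<le> log_sum g z * B"
proof -
  \<comment> \<open>\<open>v n p\<close> is the exact power of \<open>p\<close> in \<open>n\<close>,
    \<open>\<phi>\<close> splits it off, and \<open>\<psi>\<close> is the weight of the resulting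
    pair.\<close>
  define v :: "nat \<Rightarrow> nat \<Rightarrow> nat" where "v = (\<lambda>n p. p ^ multiplicity p n)"
  define \<psi> where "\<psi> = (\<lambda>(m, q). g m / real m * (g q * ln (real q) / real q))"
  define \<phi> where "\<phi> = (\<lambda>(n, p). (n div v n p, v n p))"
  let ?M = "{m. 1 \<le> m \<and> real m \<le> z}"
  let ?Q = "\<lambda>m. {q. primepow q \<and> m * q \<in> I}"
  have facts: "primepow (v n p)" "n = n div v n p * v n p" "coprime (n div v n p) (v n p)" "n div v n p \<ge> 1"
    if "n \<in> I" "p \<in> prime_factors n" for n p
  proof -
    have n0: "n \<noteq> 0" and p: "prime p" "p dvd n" using that assms(2) by (auto simp: in_prime_factors_iff intro: gr0I)
    hence m0: "multiplicity p n > 0" by (simp add: prime_multiplicity_gt_zero_iff)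
    thus "primepow (v n p)" using p by (simp add: v_def)
    show eq: "n = n div v n p * v n p" by (simp add: v_def multiplicity_dvd)
    have "\<not> p dvd n div v n p" unfolding v_def using n0 p
      by (intro multiplicity_decompose) auto
    thus "coprime (n div v n p) (v n p)" using p
      unfolding v_def by (simp add: coprime_commute prime_imp_coprime coprime_power_right_iff)
    show "n div v n p \<ge> 1" using eq n0 by (metis One_nat_def Suc_leI gr0I mult_is_0)
  qed
  have finQ: "finite (?Q m)" if "m \<ge> 1" for m
  proof (rule finite_subset)
    show "?Q m \<subseteq> {..nat \<lfloor>z\<rfloor>}"
    proof clarify
      fix q assume "m * q \<in> I"
      hence "real (m * q) \<le> z" by (rule assms(3))
      moreover have "real q \<le> real (m * q)" using mult_le_mono1[OF that, of q] by linarith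
      ultimately show "q \<le> nat \<lfloor>z\<rfloor>" by (simp add: le_nat_iff le_floor_iff)
    qed
  qed simp
  have "(\<Sum>n\<in>I. g n * ln (real n) / real n) = (\<Sum>n\<in>I. \<Sum>p\<in>prime_factors n. \<psi> (\<phi> (n, p)))"
  proof (rule sum.cong[OF refl])
    fix n assume n: "n \<in> I"
    hence "n > 0" using assms(2) by (auto intro: gr0I)
    have "g n * ln (real n) / real n = (\<Sum>p\<in>prime_factors n. g n * ln (real (v n p)) / real n)"
      using ln_eq_sum_prime_factors[OF \<open>n > 0\<close>]
      by (simp add: v_def sum_divide_distrib sum_distrib_left)
    also have "\<dots> = (\<Sum>p\<in>prime_factors n. \<psi> (\<phi> (n, p)))"
    proof (rule sum.cong[OF refl])
      fix p assume p: "p \<in> prime_factors n"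
      have "g n = g (n div v n p) * g (v n p)"
        using multiplicative_coprime[OF g_mult facts(3)[OF n p]] facts(2)[OF n p] by simp
      moreover have "real n = real (n div v n p) * real (v n p)"
        using arg_cong[OF facts(2)[OF n p], of real] by simp
      ultimately show "g n * ln (real (v n p)) / real n = \<psi> (\<phi> (n, p))"
        by (simp add: \<psi>_def \<phi>_def)
    qed
    finally show "g n * ln (real n) / real n = (\<Sum>p\<in>prime_factors n. \<psi> (\<phi> (n, p)))" .
  qed
  also have "\<dots> = (\<Sum>z\<in>Sigma I prime_factors. \<psi> (\<phi> z))"
    using assms(1) by (subst sum.Sigma) (auto simp: case_prod_unfold)
  also have "\<dots> = (\<Sum>z\<in>\<phi> ` Sigma I prime_factors. \<psi> z)"
  proof (subst sum.reindex)
    \<comment> \<open>Multiplying the two components returns \<open>n\<close>; the second one is a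
      nontrivial power of \<open>p\<close> and so determines \<open>p\<close>.\<close>
    show "inj_on \<phi> (Sigma I prime_factors)"
    proof (rule inj_onI, clarify)
      fix n p n' p'
      assume *: "n \<in> I" "p \<in> prime_factors n" "n' \<in> I" "p' \<in> prime_factors n'" "\<phi> (n, p) = \<phi> (n', p')"
      have "fst (\<phi> (n, p)) * snd (\<phi> (n, p)) = n" "fst (\<phi> (n', p')) * snd (\<phi> (n', p')) = n'"
        using facts(2)[OF *(1,2)] facts(2)[OF *(3,4)] by (simp_all add: \<phi>_def)
      hence "n = n'" using *(5) by simp
      moreover have "v n p \<noteq> 1" using facts(1)[OF *(1,2)] by auto
      hence "multiplicity p n \<noteq> 0" by (auto simp: v_def)
      moreover have "p ^ multiplicity p n = p' ^ multiplicity p' n'" using *(5) by (simp add: \<phi>_def v_def)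
      ultimately show "n = n' \<and> p = p'"
        using *(2,4) by (simp add: prime_power_inj'' in_prime_factors_iff)
    qed
  qed simp
  also have "\<dots> \<le> (\<Sum>z\<in>Sigma ?M ?Q. \<psi> z)"
  proof (rule sum_mono2)
    show "finite (Sigma ?M ?Q)" using finQ by (intro finite_SigmaI) auto
    show "\<phi> ` Sigma I prime_factors \<subseteq> Sigma ?M ?Q"
    proof
      fix y assume "y \<in> \<phi> ` Sigma I prime_factors"
      then obtain n p where n: "n \<in> I" and p: "p \<in> prime_factors n" and y: "y = \<phi> (n, p)" by auto
      obtain m q where mq: "\<phi> (n, p) = (m, q)" by (cases "\<phi> (n, p)")
      have "fst (\<phi> (n, p)) * snd (\<phi> (n, p)) = n" using facts(2)[OF n p] by (simp add: \<phi>_def)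
      hence "m * q = n" using mq by simp
      moreover have "m \<le> n" using mq by (auto simp: \<phi>_def)
      hence "real m \<le> z" using assms(3)[OF n] by linarith
      ultimately show "y \<in> Sigma ?M ?Q"
        using n facts(1,4)[OF n p] mq y by (auto simp: \<phi>_def)
    qed
    show "0 \<le> \<psi> y" if "y \<in> Sigma ?M ?Q - \<phi> ` Sigma I prime_factors" for y
      using that g_nonneg by (auto simp: \<psi>_def intro!: mult_nonneg_nonneg divide_nonneg_nonneg dest: primepow_gt_0_nat)
  qed
  also have "\<dots> = (\<Sum>m\<in>?M. \<Sum>q\<in>?Q m. \<psi> (m, q))"
    using finQ by (subst sum.Sigma) auto
  also have "\<dots> = (\<Sum>m\<in>?M. g m / real m * (\<Sum>q\<in>?Q m. g q * ln (real q) / real q))"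
    by (simp add: \<psi>_def sum_distrib_left)
  also have "\<dots> \<le> (\<Sum>m\<in>?M. g m / real m * B)"
    using finQ g_nonneg by (intro sum_mono mult_left_mono W) auto
  also have "\<dots> = log_sum g z * B" by (simp add: log_sum_def sum_distrib_right)
  finally show ?thesis .
qed

text \<open>In this range ln n \<ge> ln x, so dividing the logarithmically weighted sum by ln x
  suffices. For fixed m the prime powers q = n/m fill a window of ratio x^\<epsilon>, which
  O(\<epsilon> ln x + 1) dyadic blocks cover.\<close>

lemma short_log_sum_le:
  assumes "ln x \<ge> 1" "0 < \<epsilon>" "\<epsilon> \<le> 1" "x > 0"
  shows "(\<Sum>n | x < real n \<and> real n \<le> x powr (1 + \<epsilon>). g n / real n) \<le>
           4 * C * exp 2 * (\<epsilon> + 1 / ln x) * dser g (1 / ln x)"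
proof -
  define L z where "L = ln x" and "z = x powr (1 + \<epsilon>)"
  \<comment> \<open>Number of doublings needed to cover the ratio x^\<epsilon>.\<close>
  define J where "J = nat \<lceil>\<epsilon> * L / ln 2\<rceil>"
  define B where "B = 2 * C * (2 * \<epsilon> * L + 1)"
  let ?I = "{n. x < real n \<and> real n \<le> z}"
  have L: "L \<ge> 1" using assms by (simp add: L_def)
  have ln2: "ln (2::real) \<ge> 1 / 2" using ln2_ge_two_thirds by simp
  have J1: "real J \<le> 2 * \<epsilon> * L + 1"
  proof -
    have "real J < \<epsilon> * L / ln 2 + 1" using assms L unfolding J_def by (simp add: ceiling_less_iff) linarith
    also have "\<epsilon> * L / ln 2 \<le> \<epsilon> * L / (1 / 2)" using assms L ln2 by (intro divide_left_mono) auto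
    finally show ?thesis by simp
  qed
  have J2: "x powr \<epsilon> \<le> 2 ^ J"
  proof -
    have "\<epsilon> * L / ln 2 \<le> real J" unfolding J_def by (rule real_nat_ceiling_ge)
    hence "\<epsilon> * L \<le> real J * ln 2" using ln2 by (simp add: divide_le_eq)
    hence "exp (\<epsilon> * L) \<le> exp (real J * ln 2)" by simp
    also have "\<dots> = 2 ^ J" by (simp add: exp_of_nat_mult)
    finally show ?thesis using assms by (simp add: powr_def L_def)
  qed
  have "L * (\<Sum>n\<in>?I. g n / real n) \<le> (\<Sum>n\<in>?I. g n * ln (real n) / real n)"
    unfolding sum_distrib_left
  proof (rule sum_mono)
    fix n assume "n \<in> ?I"
    hence "L \<le> ln (real n)" using assms by (simp add: L_def)
    hence "L * (g n / real n) \<le> ln (real n) * (g n / real n)" using g_nonneg by (intro mult_right_mono) auto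
    thus "L * (g n / real n) \<le> g n * ln (real n) / real n" by (simp add: mult_ac)
  qed
  also have "\<dots> \<le> log_sum g z * B"
  proof (rule log_weighted_sum_le)
    show "finite ?I" by simp
    show "0 \<notin> ?I" using assms by auto
    fix m :: nat and Q assume m: "m \<ge> 1" and Q: "finite Q" "\<And>q. q \<in> Q \<Longrightarrow> primepow q \<and> m * q \<in> ?I"
    \<comment> \<open>\<open>pp_window\<close> requires \<open>y \<ge> 1\<close>. Prime powers
      exceed 1, so none is lost when \<open>x / m\<close> is smaller.\<close>
    define y where "y = max 1 (x / real m)"
    have "(\<Sum>q\<in>Q. g q * ln (real q) / real q) \<le> 2 * C * real J"
    proof (rule pp_window[OF Q(1)])
      show "y \<ge> 1" by (simp add: y_def)
      fix q assume q: "q \<in> Q"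
      have pq: "primepow q" "x < real m * real q" "real m * real q \<le> z" using Q(2)[OF q] by auto
      have "real q > 1" using primepow_gt_Suc_0[OF pq(1)] by simp
      hence "y < real q" using pq(2) m by (simp add: y_def field_simps)
      have "real q \<le> x powr \<epsilon> * (x / real m)"
        using pq(3) m assms by (simp add: z_def powr_add field_simps)
      also have "\<dots> \<le> 2 ^ J * y"
        using J2 assms m by (intro mult_mono) (auto simp: y_def)
      finally show "primepow q \<and> y < real q \<and> real q \<le> 2 ^ J * y"
        using pq(1) \<open>y < real q\<close> by simp
    qed
    also have "\<dots> \<le> B" unfolding B_def using J1 C_nonneg by (intro mult_left_mono) auto
    finally show "(\<Sum>q\<in>Q. g q * ln (real q) / real q) \<le> B" .
  qed auto
  also have "\<dots> \<le> (exp 2 * dser g (1 / L)) * B"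
  proof (rule mult_right_mono)
    have "x \<ge> 1" using assms(1,4) ln_ge_zero_iff[of x] by linarith
    hence "z \<ge> 1" unfolding z_def using assms by (intro ge_one_powr_ge_zero) auto
    hence "log_sum g z \<le> z powr (1 / L) * dser g (1 / L)"
      using L by (intro log_sum_g_le_dser) auto
    also have "z powr (1 / L) = exp (1 + \<epsilon>)"
      using assms L by (cases "x = 1") (auto simp: z_def powr_powr powr_def L_def)
    also have "exp (1 + \<epsilon>) * dser g (1 / L) \<le> exp 2 * dser g (1 / L)"
      using assms dser_g_ge[of "1 / L"] L by (intro mult_right_mono) auto
    finally show "log_sum g z \<le> exp 2 * dser g (1 / L)" .
    show "B \<ge> 0" using assms L C_nonneg by (simp add: B_def)
  qed
  finally have "(\<Sum>n\<in>?I. g n / real n) \<le> exp 2 * dser g (1 / L) * B / L"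
    using L by (simp add: field_simps)
  also have "\<dots> = exp 2 * dser g (1 / L) * (2 * C) * (2 * \<epsilon> + 1 / L)"
    using L by (simp add: B_def field_simps)
  also have "\<dots> \<le> exp 2 * dser g (1 / L) * (2 * C) * (2 * (\<epsilon> + 1 / L))"
    using L assms C_nonneg dser_g_ge[of "1 / L"]
    by (intro mult_left_mono) (auto intro: divide_right_mono)
  also have "\<dots> = 4 * C * exp 2 * (\<epsilon> + 1 / L) * dser g (1 / L)"
    by (simp add: algebra_simps)
  finally show ?thesis by (simp add: L_def z_def)
qed

end

subsection \<open>Comparison of the local factors\<close>

text \<open>Stated for arbitrary finite sets because it is applied to the primes in an
  interval.\<close>

lemma summable_tail_small:
  fixes f :: "nat \<Rightarrow> real"
  assumes "summable f" "\<And>n. f n \<ge> 0" "e > 0"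
  obtains N where "\<And>A. finite A \<Longrightarrow> A \<subseteq> {N<..} \<Longrightarrow> sum f A < e"
proof -
  obtain N where N: "\<And>m n. m \<ge> N \<Longrightarrow> norm (sum f {m..<n}) < e"
    using assms(1,3) unfolding summable_Cauchy by blast
  have "sum f A < e" if "finite A" "A \<subseteq> {N<..}" for A
  proof -
    have "A \<subseteq> {N..<Suc (Max (insert 0 A))}"
      using that by (auto simp: less_Suc_eq_le)
    hence "sum f A \<le> sum f {N..<Suc (Max (insert 0 A))}"
      using assms(2) by (intro sum_mono2) auto
    also have "\<dots> < e" using N[of N "Suc (Max (insert 0 A))"] by simp
    finally show ?thesis .
  qed
  thus ?thesis using that by blast
qed

text \<open>Transfers limits for \<sigma> tending to 0 from the right to \<sigma> = c / ln x with x
  tending to infinity.\<close>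

lemma filterlim_div_ln: 
  assumes "c > (0::real)"
  shows "filterlim (\<lambda>x. c / ln x) (at_right 0) at_top"
proof (rule tendsto_imp_filterlim_at_right)
  show "((\<lambda>x. c / ln x) \<longlongrightarrow> 0) at_top"
    by (intro tendsto_divide_0[OF tendsto_const] filterlim_at_top_imp_at_infinity ln_at_top)
  show "\<forall>\<^sub>F x in at_top. c / ln x > 0"
    using eventually_gt_at_top[of 1] by eventually_elim (use assms in auto)
qed

locale dominated_mult = chebyshev_mult +
  fixes h :: "nat \<Rightarrow> complex"
  assumes h_mult: "multiplicative h"
    and h_le: "n \<ge> 1 \<Longrightarrow> norm (h n) \<le> g n"
begin

lemma dominated_h: "dominated h"
  using h_mult h_le by (auto simp: dominated_def)

definition rat :: "real \<Rightarrow> nat \<Rightarrow> complex" where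
  "rat \<sigma> p = efac h \<sigma> p / complex_of_real (efac g \<sigma> p)"

text \<open>The product P(x) of the introduction, with \<open>N\<close> the integer part of
  x.\<close>

definition rat_prod :: "nat \<Rightarrow> complex" where
  "rat_prod N = (\<Prod>p\<in>primes_upto N. rat 0 p)"

text \<open>The terms of the series whose convergence is derived when the products stay away from 0;
  the zeros off the primes turn it into a plain sequence.\<close>

definition defect :: "nat \<Rightarrow> real" where
  "defect p = (if prime p then (g p - Re (h p)) / real p else 0)"

lemma Re_h_le: "n \<ge> 1 \<Longrightarrow> Re (h n) \<le> g n"
  using complex_Re_le_cmod[of "h n"] h_le[of n] by simp

lemma defect_nonneg: "defect p \<ge> 0"
  using Re_h_le[of p] by (auto simp: defect_def dest: prime_ge_1_nat)

text \<open>The square of the left side is at most 2 g (g - Re h), and 4uv \<le> (u + v)^2 splits it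
  with weight \<eta>. A small \<eta> tames the \<open>g\<close> part, while the other part leads to
  the series of \<open>defect\<close>.\<close>

lemma norm_g_minus_h_le:
  assumes "n \<ge> 1" "\<eta> > 0"
  shows "norm (complex_of_real (g n) - h n) \<le> \<eta> * g n + (g n - Re (h n)) / (2 * \<eta>)"
proof (rule power2_le_imp_le)
  have nh: "(norm (h n))\<^sup>2 \<le> (g n)\<^sup>2" using h_le[OF assms(1)] by (intro power_mono) auto
  have "(norm (complex_of_real (g n) - h n))\<^sup>2 = (g n)\<^sup>2 - 2 * g n * Re (h n) + (norm (h n))\<^sup>2"
    unfolding cmod_power2 by (simp add: power2_eq_square algebra_simps)
  also have "\<dots> \<le> 2 * g n * (g n - Re (h n))" using nh by (simp add: power2_eq_square algebra_simps)
  also have "\<dots> = 4 * (\<eta> * g n) * ((g n - Re (h n)) / (2 * \<eta>))" using assms(2) by simp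
  also have "\<dots> \<le> (\<eta> * g n + (g n - Re (h n)) / (2 * \<eta>))\<^sup>2"
  proof -
    have "4 * u * v \<le> (u + v)\<^sup>2" for u v :: real
      using zero_le_power2[of "u - v"] by (simp add: power2_sum power2_diff)
    thus ?thesis .
  qed
  finally show "(norm (complex_of_real (g n) - h n))\<^sup>2 \<le> (\<eta> * g n + (g n - Re (h n)) / (2 * \<eta>))\<^sup>2" .
  show "0 \<le> \<eta> * g n + (g n - Re (h n)) / (2 * \<eta>)"
    using assms g_nonneg Re_h_le by simp
qed

lemma norm_rat_le_1:
  assumes "prime p" "\<sigma> \<ge> 0"
  shows "norm (rat \<sigma> p) \<le> 1"
  using norm_efac_le[OF dominated_h assms] efac_g_ge[OF assms]
  by (simp add: rat_def norm_divide divide_le_eq)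

lemma htail_le_suminf: "htail p \<le> suminf htail"
  using sum_le_suminf[OF summable_htail, of "{p}"] htail_nonneg by simp

definition efac_diff :: "real \<Rightarrow> nat \<Rightarrow> complex" where
  "efac_diff \<sigma> p = complex_of_real (efac g \<sigma> p) - efac h \<sigma> p"

text \<open>Both local factors equal 1 plus their linear term up to \<open>htail p\<close>, so two
  such errors add up.\<close>

lemma efac_diff_approx:
  assumes "prime p" "\<sigma> \<ge> 0"
  shows "norm (efac_diff \<sigma> p - (complex_of_real (g p) - h p) / of_nat p * complex_of_real (real p powr (- \<sigma>))) \<le> 2 * htail p"
proof -
  have "norm (complex_of_real (efac g \<sigma> p - 1 - dterm g \<sigma> p)) \<le> htail p"
    using norm_efac_tail_le[OF dominated_g assms] by (simp only: norm_of_real real_norm_def)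
  moreover note norm_efac_tail_le[OF dominated_h assms]
  ultimately have "norm (complex_of_real (efac g \<sigma> p - 1 - dterm g \<sigma> p) - (efac h \<sigma> p - 1 - dterm h \<sigma> p)) \<le> htail p + htail p"
    by (rule order.trans[OF norm_triangle_ineq4 add_mono])
  also have "complex_of_real (efac g \<sigma> p - 1 - dterm g \<sigma> p) - (efac h \<sigma> p - 1 - dterm h \<sigma> p) =
     efac_diff \<sigma> p - (complex_of_real (g p) - h p) / of_nat p * complex_of_real (real p powr (- \<sigma>))"
    by (simp add: efac_diff_def dterm_def algebra_simps diff_divide_distrib)
  finally show ?thesis by simp
qed

lemma norm_efac_diff_le:
  assumes "prime p" "\<sigma> \<ge> 0"
  shows "norm (efac_diff \<sigma> p) \<le> norm (complex_of_real (g p) - h p) / real p * real p powr (- \<sigma>) + 2 * htail p"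
proof -
  let ?a = "(complex_of_real (g p) - h p) / of_nat p * complex_of_real (real p powr (- \<sigma>))"
  have "norm (efac_diff \<sigma> p) \<le> norm ?a + norm (efac_diff \<sigma> p - ?a)" by (rule norm_triangle_sub)
  thus ?thesis using efac_diff_approx[OF assms] by (simp add: norm_mult norm_divide)
qed

lemma one_minus_rat:
  assumes "prime p" "\<sigma> \<ge> 0"
  shows "1 - rat \<sigma> p = efac_diff \<sigma> p / complex_of_real (efac g \<sigma> p)"
  using efac_g_ge[OF assms] by (simp add: rat_def efac_diff_def diff_divide_distrib)

lemma norm_one_minus_rat_le:
  assumes "prime p" "\<sigma> \<ge> 0"
  shows "norm (1 - rat \<sigma> p) \<le> norm (complex_of_real (g p) - h p) / real p * real p powr (- \<sigma>) + 2 * htail p"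
proof -
  have "norm (1 - rat \<sigma> p) \<le> norm (efac_diff \<sigma> p)"
    using efac_g_ge[OF assms] mult_left_mono[of 1 "efac g \<sigma> p" "norm (efac_diff \<sigma> p)"]
    by (simp add: one_minus_rat[OF assms] norm_divide divide_le_eq)
  thus ?thesis using norm_efac_diff_le[OF assms] by linarith
qed

lemma norm_g_minus_h_le_2\<beta>:
  assumes "prime p"
  shows "norm (complex_of_real (g p) - h p) / real p \<le> 2 * \<beta> / real p"
    and "2 * \<beta> / real p \<le> 2 * \<beta>"
proof -
  have "norm (complex_of_real (g p) - h p) \<le> g p + g p"
    using norm_triangle_ineq4[of "complex_of_real (g p)" "h p"] h_le[of p] g_nonneg[of p] prime_ge_1_nat[OF assms] by simp
  thus "norm (complex_of_real (g p) - h p) / real p \<le> 2 * \<beta> / real p"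
    using g_prime_le[OF assms] by (intro divide_right_mono) auto
  show "2 * \<beta> / real p \<le> 2 * \<beta>"
    using \<beta>_nonneg prime_ge_1_nat[OF assms] mult_left_mono[of 1 "real p" \<beta>] by (simp add: divide_le_eq)
qed

text \<open>Collects the coefficients of \<open>htail p\<close> in \<open>norm_rat_diff_le\<close>:
  4 from the change of the numerator, the rest from the change of the denominator.\<close>

definition K :: real where "K = 4 + 6 * \<beta> + 4 * suminf htail"

lemma K_nonneg: "K \<ge> 0"
  using \<beta>_nonneg suminf_nonneg[OF summable_htail htail_nonneg] by (simp add: K_def)

text \<open>Every error that is not of size \<open>htail p\<close> carries both |g(p) - h(p)| / p
  and 1 - p^(-\<sigma>) \<le> \<sigma> ln p. The first factor is kept so that
  \<open>norm_g_minus_h_le\<close> can be applied later.\<close>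

lemma norm_rat_diff_le:
  assumes p: "prime p" and \<sigma>: "\<sigma> \<ge> 0"
  shows "norm (rat \<sigma> p - rat 0 p) \<le>
    (1 + \<beta>) * (norm (complex_of_real (g p) - h p) / real p) * (\<sigma> * ln (real p)) + K * htail p"
proof -
  define d where "d = norm (complex_of_real (g p) - h p) / real p"
  define u where "u = 1 - real p powr (- \<sigma>)"
  define D D0 where "D = efac g \<sigma> p" and "D0 = efac g 0 p"
  define E E0 where "E = efac_diff \<sigma> p" and "E0 = efac_diff 0 p"
  have p1: "real p \<ge> 1" using prime_ge_1_nat[OF p] by simp
  have u: "0 \<le> u" "u \<le> 1" "u \<le> \<sigma> * ln (real p)"
    using exp_ge_add_one_self[of "- (\<sigma> * ln (real p))"] p1 \<sigma> prime_gt_1_nat[OF p]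
    by (auto simp: u_def powr_def)
  have d: "0 \<le> d" "d \<le> 2 * \<beta>" using norm_g_minus_h_le_2\<beta>[OF p] by (auto simp: d_def)
  have T: "0 \<le> htail p" "htail p \<le> suminf htail" by (rule htail_nonneg htail_le_suminf)+
  have D: "D \<ge> 1" "D0 \<ge> 1" using efac_g_ge[OF p] \<sigma> by (auto simp: D_def D0_def)
  have "1 - rat 0 p - (1 - rat \<sigma> p) = E0 / D0 - E / D"
    using one_minus_rat[OF p] \<sigma> by (simp add: D_def D0_def E_def E0_def)
  \<comment> \<open>The change of the denominator is multiplied by \<open>E0\<close>, which is
    itself small in terms of |g(p) - h(p)| / p.\<close>
  also have "\<dots> = (E0 - E) / D + E0 * (D - D0) / (D * D0)"
    using D by (simp add: field_simps)
  finally have "norm (rat \<sigma> p - rat 0 p) = norm ((E0 - E) / D + E0 * (D - D0) / (D * D0))"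
    by (simp add: algebra_simps)
  also have "\<dots> \<le> norm ((E0 - E) / D) + norm (E0 * (D - D0) / (D * D0))" by (rule norm_triangle_ineq)
  also have "\<dots> \<le> norm (E0 - E) + norm E0 * \<bar>D - D0\<bar>"
  proof (rule add_mono)
    show "norm ((E0 - E) / D) \<le> norm (E0 - E)"
      using D mult_left_mono[of 1 D "norm (E0 - E)"] by (simp add: norm_divide divide_le_eq)
    have "1 \<le> D * D0" using D mult_mono[of 1 D 1 D0] by simp
    hence "norm E0 * \<bar>D - D0\<bar> * 1 \<le> norm E0 * \<bar>D - D0\<bar> * (D * D0)" by (intro mult_left_mono) auto
    moreover have "norm (complex_of_real D - complex_of_real D0) = \<bar>D - D0\<bar>"
      by (metis norm_of_real of_real_diff)
    ultimately show "norm (E0 * (D - D0) / (D * D0)) \<le> norm E0 * \<bar>D - D0\<bar>"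
      using D by (simp add: norm_divide norm_mult divide_le_eq)
  qed
  also have "norm (E0 - E) \<le> d * u + 4 * htail p"
  proof -
    define a where "a = (complex_of_real (g p) - h p) / of_nat p"
    define t where "t = complex_of_real (real p powr (- \<sigma>))"
    have "norm (E0 - a) \<le> 2 * htail p" using efac_diff_approx[OF p, of 0] p1 by (simp add: E0_def a_def)
    moreover have "norm (E - a * t) \<le> 2 * htail p" using efac_diff_approx[OF p \<sigma>] by (simp add: E_def a_def t_def)
    moreover have "norm (a * (1 - t)) = d * u"
    proof -
      have "1 - t = complex_of_real u" by (simp add: u_def t_def)
      thus ?thesis using u by (simp add: norm_mult norm_divide d_def a_def)
    qed
    moreover have "E0 - E = a * (1 - t) + ((E0 - a) - (E - a * t))" by (simp add: algebra_simps)
    hence "norm (E0 - E) \<le> norm (a * (1 - t)) + (norm (E0 - a) + norm (E - a * t))"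
      by (metis add_left_mono norm_triangle_ineq norm_triangle_ineq4 order.trans)
    ultimately show ?thesis by linarith
  qed
  also have "norm E0 * \<bar>D - D0\<bar> \<le> (d + 2 * htail p) * (\<beta> * u + 2 * htail p)"
  proof (rule mult_mono)
    show "norm E0 \<le> d + 2 * htail p"
      using norm_efac_diff_le[OF p, of 0] p1 by (simp add: E0_def d_def)
    have "\<bar>D - 1 - dterm g \<sigma> p\<bar> \<le> htail p" "\<bar>D0 - 1 - dterm g 0 p\<bar> \<le> htail p"
      using norm_efac_tail_le[OF dominated_g p, of \<sigma>] norm_efac_tail_le[OF dominated_g p, of 0] \<sigma>
      by (simp_all add: D_def D0_def)
    moreover have "dterm g 0 p - dterm g \<sigma> p = g p / real p * u"
      using p1 by (simp add: dterm_def u_def algebra_simps)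
    moreover have "g p / real p * u \<le> \<beta> * u"
    proof (rule mult_right_mono)
      have "g p / real p \<le> g p / 1" using p1 g_nonneg by (intro divide_left_mono) auto
      thus "g p / real p \<le> \<beta>" using g_prime_le[OF p] by simp
    qed (rule u)
    moreover have "g p / real p * u \<ge> 0" using u g_nonneg by simp
    ultimately show "\<bar>D - D0\<bar> \<le> \<beta> * u + 2 * htail p" by linarith
  qed (use d T in auto)
  also have "\<dots> = \<beta> * (d * u) + (2 * d + 2 * \<beta> * u + 4 * htail p) * htail p"
    by (simp add: algebra_simps)
  also have "\<dots> \<le> \<beta> * (d * u) + (4 * \<beta> + 2 * \<beta> + 4 * suminf htail) * htail p"
    using d u T \<beta>_nonneg mult_left_mono[of u 1 "2 * \<beta>"]
    by (intro add_left_mono mult_right_mono add_mono) auto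
  finally have "norm (rat \<sigma> p - rat 0 p) \<le> (1 + \<beta>) * d * u + K * htail p"
    by (simp add: K_def algebra_simps)
  also have "(1 + \<beta>) * d * u \<le> (1 + \<beta>) * d * (\<sigma> * ln (real p))"
    using u d \<beta>_nonneg by (intro mult_left_mono) auto
  finally show ?thesis by (simp add: d_def)
qed

text \<open>Termwise passage to the limit, justified by the majorant at \<sigma> = 0.\<close>

lemma efac_tendsto_0:
  fixes f :: "nat \<Rightarrow> 'a :: {real_normed_field, banach}"
  assumes "dominated f" "prime p"
  shows "((\<lambda>\<sigma>. efac f \<sigma> p) \<longlongrightarrow> efac f 0 p) (at_right 0)"
proof -
  have "((\<lambda>\<sigma>. dterm f \<sigma> (p ^ k)) \<longlongrightarrow> dterm f 0 (p ^ k)) (at_right 0)" for k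
  proof -
    have "((\<lambda>\<sigma>. real (p ^ k) powr (- \<sigma>)) \<longlongrightarrow> real (p ^ k) powr (- 0)) (at_right 0)"
      by (intro tendsto_intros) (use prime_gt_0_nat[OF assms(2)] in auto)
    thus ?thesis unfolding dterm_def
      by (intro tendsto_intros) (use prime_gt_0_nat[OF assms(2)] in simp)
  qed
  moreover have "\<forall>\<^sub>F (k, \<sigma>) in at_top \<times>\<^sub>F at_right 0. norm (dterm f \<sigma> (p ^ k)) \<le> dterm g 0 (p ^ k)"
  proof -
    have "\<forall>\<^sub>F \<sigma> in at_right 0. \<sigma> \<ge> (0::real)"
      using eventually_at_right_less[of "0::real"] by eventually_elim simp
    thus ?thesis unfolding eventually_prod_filter
      by (intro exI[of _ "\<lambda>_. True"] exI[of _ "\<lambda>\<sigma>. \<sigma> \<ge> 0"])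
         (auto intro: norm_dterm_le[OF assms(1)])
  qed
  moreover have "summable (\<lambda>k. dterm g 0 (p ^ k))" using assms by (intro summable_dterm_g_prime_powers) auto
  ultimately show ?thesis unfolding efac_def
    using tannerys_theorem[of "\<lambda>k \<sigma>. dterm f \<sigma> (p ^ k)" "\<lambda>k. dterm f 0 (p ^ k)" "at_right 0" "\<lambda>k. dterm g 0 (p ^ k)"]
    by auto
qed

lemma rat_tendsto_0:
  assumes "prime p"
  shows "((\<lambda>\<sigma>. rat \<sigma> p) \<longlongrightarrow> rat 0 p) (at_right 0)"
  unfolding rat_def
  by (intro tendsto_intros efac_tendsto_0 dominated_g dominated_h assms)
     (use efac_g_ge[OF assms, of 0] in auto)

section \<open>The quotient F_h/F_g and its relation to P(x)\<close>

definition dser_rat :: "real \<Rightarrow> complex" where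
  "dser_rat \<sigma> = dser h \<sigma> / complex_of_real (dser g \<sigma>)"

lemma dser_rat_euler:
  assumes "\<sigma> > 0"
  shows "(\<lambda>N. \<Prod>p\<in>primes_upto N. rat \<sigma> p) \<longlonglongrightarrow> dser_rat \<sigma>"
proof -
  have "(\<lambda>N. (\<Prod>p\<in>primes_upto N. efac h \<sigma> p) / complex_of_real (\<Prod>p\<in>primes_upto N. efac g \<sigma> p)) \<longlonglongrightarrow> dser_rat \<sigma>"
    unfolding dser_rat_def using dser_g_ge[OF assms] assms
    by (intro tendsto_divide tendsto_of_real dser_euler dominated_g dominated_h) auto
  thus ?thesis by (simp add: rat_def prod_dividef)
qed

lemma norm_prod_rat_mono:
  assumes "M \<le> N" "\<sigma> \<ge> 0"
  shows "norm (\<Prod>p\<in>primes_upto N. rat \<sigma> p) \<le> norm (\<Prod>p\<in>primes_upto M. rat \<sigma> p)"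
proof -
  have sub: "primes_upto M \<subseteq> primes_upto N" using assms by (auto simp: primes_upto_def)
  have "(\<Prod>p\<in>primes_upto N. rat \<sigma> p) = (\<Prod>p\<in>primes_upto N - primes_upto M. rat \<sigma> p) * (\<Prod>p\<in>primes_upto M. rat \<sigma> p)"
    by (rule prod.subset_diff[OF sub]) simp
  moreover have "norm (\<Prod>p\<in>primes_upto N - primes_upto M. rat \<sigma> p) \<le> 1"
    unfolding prod_norm[symmetric] using assms
    by (intro prod_le_1) (auto simp: primes_upto_def norm_rat_le_1)
  ultimately show ?thesis
    by (simp add: norm_mult mult_left_le_one_le)
qed

lemma norm_rat_prod_le_1: "norm (rat_prod N) \<le> 1"
  unfolding rat_prod_def prod_norm[symmetric]
  by (intro prod_le_1) (auto simp: primes_upto_def norm_rat_le_1)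

text \<open>All factors have norm at most 1, so the first \<open>N\<close> of them bound both terms
  of the difference. For fixed \<open>N\<close> the finite product is continuous at \<sigma> = 0,
  where it is already small.\<close>

lemma dser_rat_limit_vanishing:
  assumes "c > 0" and van: "\<And>e. e > 0 \<Longrightarrow> \<exists>N. norm (rat_prod N) < e"
  shows "((\<lambda>x. dser_rat (c / ln x) - rat_prod (nat \<lfloor>x\<rfloor>)) \<longlongrightarrow> 0) at_top"
proof (rule tendstoI)
  fix e :: real assume e: "e > 0"
  obtain N where N: "norm (rat_prod N) < e / 2" using van[of "e / 2"] e by auto
  have "((\<lambda>\<sigma>. norm (\<Prod>p\<in>primes_upto N. rat \<sigma> p)) \<longlongrightarrow> norm (rat_prod N)) (at_right 0)"
    unfolding rat_prod_def by (intro tendsto_intros rat_tendsto_0) (auto simp: primes_upto_def)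
  hence "\<forall>\<^sub>F \<sigma> in at_right 0. norm (\<Prod>p\<in>primes_upto N. rat \<sigma> p) < e / 2"
    using N by (rule order_tendstoD)
  hence "\<forall>\<^sub>F x in at_top. norm (\<Prod>p\<in>primes_upto N. rat (c / ln x) p) < e / 2"
    using filterlim_div_ln[OF assms(1)] by (rule eventually_compose_filterlim)
  thus "\<forall>\<^sub>F x in at_top. dist (dser_rat (c / ln x) - rat_prod (nat \<lfloor>x\<rfloor>)) 0 < e"
    using eventually_ge_at_top[of "real N"] eventually_gt_at_top[of 1]
  proof eventually_elim
    case (elim x)
    have \<sigma>: "c / ln x > 0" using elim assms by simp
    have "norm (dser_rat (c / ln x)) \<le> norm (\<Prod>p\<in>primes_upto N. rat (c / ln x) p)"
      by (rule Lim_norm_ubound[OF _ dser_rat_euler[OF \<sigma>]])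
         (use norm_prod_rat_mono[of N] \<sigma> in \<open>auto simp: eventually_sequentially intro!: exI[of _ N]\<close>)
    moreover have "N \<le> nat \<lfloor>x\<rfloor>" using elim by (simp add: le_nat_iff le_floor_iff)
    hence "norm (rat_prod (nat \<lfloor>x\<rfloor>)) \<le> norm (rat_prod N)"
      unfolding rat_prod_def by (intro norm_prod_rat_mono) auto
    moreover have "norm (dser_rat (c / ln x) - rat_prod (nat \<lfloor>x\<rfloor>)) \<le> norm (dser_rat (c / ln x)) + norm (rat_prod (nat \<lfloor>x\<rfloor>))"
      by (rule norm_triangle_ineq4)
    ultimately show ?case using elim N by simp
  qed
qed

text \<open>With w = 1 - \<open>rat 0 p\<close>, expanding the square of |1 - w| bounds Re w by 1 -
  |1 - w| plus half of |w|^2. By condition (a), |w|^2 is of order 1/p^2 + \<open>htail p\<close>.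
  Finally Re w times the local factor of \<open>g\<close> is \<open>defect p\<close> up to
  \<open>2 * htail p\<close>.\<close>

lemma defect_le:
  assumes p: "prime p"
  shows "defect p \<le> (1 + \<beta> + suminf htail) * ((1 - norm (rat 0 p)) + 4 * \<beta>\<^sup>2 * (1 / real p ^ 2) + 4 * suminf htail * htail p) + 2 * htail p"
proof -
  define w where "w = 1 - rat 0 p"
  define D where "D = efac g 0 p"
  define B where "B = suminf htail"
  have p1: "real p \<ge> 1" using prime_ge_1_nat[OF p] by simp
  have T: "0 \<le> htail p" "htail p \<le> B" unfolding B_def by (rule htail_nonneg htail_le_suminf)+
  have D: "D \<ge> 1" using efac_g_ge[OF p] by (simp add: D_def)
  have D2: "D \<le> 1 + \<beta> + B"
  proof -
    have "\<bar>D - 1 - dterm g 0 p\<bar> \<le> htail p" using norm_efac_tail_le[OF dominated_g p, of 0] by (simp add: D_def)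
    moreover have "dterm g 0 p \<le> \<beta>"
    proof -
      have "g p / real p \<le> g p / 1" using p1 g_nonneg by (intro divide_left_mono) auto
      thus ?thesis using g_prime_le[OF p] by (simp add: dterm_zero_exponent)
    qed
    ultimately show ?thesis using T by linarith
  qed
  have r1: "norm (rat 0 p) \<le> 1" using norm_rat_le_1[OF p] by simp
  have sq: "(norm (rat 0 p))\<^sup>2 = 1 - 2 * Re w + (norm w)\<^sup>2"
    unfolding cmod_power2 w_def by (simp add: power2_eq_square algebra_simps)
  have sq1: "(norm (rat 0 p))\<^sup>2 \<le> 1" using r1 by (simp add: power_le_one)
  \<comment> \<open>The sign is what allows the local factor \<open>D\<close> to be replaced by its
    upper bound below.\<close>
  have Re0: "Re w \<ge> 0" using sq sq1 zero_le_power2[of "norm w"] by linarith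
  have "1 - (norm (rat 0 p))\<^sup>2 \<le> 2 * (1 - norm (rat 0 p))"
    using zero_le_power2[of "1 - norm (rat 0 p)"] by (simp add: power2_diff)
  hence Re_le: "Re w \<le> (1 - norm (rat 0 p)) + (norm w)\<^sup>2 / 2" using sq by simp
  have "norm w \<le> 2 * \<beta> / real p + 2 * htail p"
    using norm_one_minus_rat_le[OF p, of 0] norm_g_minus_h_le_2\<beta>[OF p] p1 by (simp add: w_def)
  hence "(norm w)\<^sup>2 \<le> (2 * \<beta> / real p + 2 * htail p)\<^sup>2" by (intro power_mono) auto
  also have "\<dots> \<le> 2 * (2 * \<beta> / real p)\<^sup>2 + 2 * (2 * htail p)\<^sup>2"
    using zero_le_power2[of "2 * \<beta> / real p - 2 * htail p"] by (simp add: power2_sum power2_diff)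
  also have "\<dots> = 8 * \<beta>\<^sup>2 * (1 / real p ^ 2) + 8 * (htail p * htail p)" by (simp add: power2_eq_square)
  also have "\<dots> \<le> 8 * \<beta>\<^sup>2 * (1 / real p ^ 2) + 8 * (B * htail p)"
    using T by (intro add_left_mono mult_left_mono mult_right_mono) auto
  finally have "Re w \<le> (1 - norm (rat 0 p)) + 4 * \<beta>\<^sup>2 * (1 / real p ^ 2) + 4 * B * htail p"
    using Re_le by simp
  moreover have "Re (efac_diff 0 p) = D * Re w"
    using one_minus_rat[OF p, of 0] D by (simp add: w_def D_def)
  moreover have "D * Re w \<le> (1 + \<beta> + B) * Re w" using D2 Re0 by (rule mult_right_mono)
  moreover have "defect p \<le> Re (efac_diff 0 p) + 2 * htail p"
  proof -
    let ?a = "(complex_of_real (g p) - h p) / of_nat p"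
    have "norm (efac_diff 0 p - ?a) \<le> 2 * htail p" using efac_diff_approx[OF p, of 0] p1 by simp
    hence "\<bar>Re (efac_diff 0 p - ?a)\<bar> \<le> 2 * htail p" using abs_Re_le_cmod order.trans by blast
    moreover have "Re ?a = defect p" using p by (simp add: defect_def)
    ultimately show ?thesis by (simp add: abs_le_iff)
  qed
  moreover have "(1 + \<beta> + B) * Re w \<le> (1 + \<beta> + B) * ((1 - norm (rat 0 p)) + 4 * \<beta>\<^sup>2 * (1 / real p ^ 2) + 4 * B * htail p)"
    using \<beta>_nonneg T calculation(1) by (intro mult_left_mono) auto
  ultimately show ?thesis unfolding B_def by linarith
qed

text \<open>Since t \<le> exp (t - 1), a lower bound \<open>l\<close> for the products gives the
  bound - ln l for the sums of 1 - |\<open>rat 0 p\<close>|. The other terms in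
  \<open>defect_le\<close> are summable over all primes.\<close>

lemma summable_defect:
  assumes "l > 0" and l: "\<And>N. norm (rat_prod N) \<ge> l"
  shows "summable defect"
proof (rule summableI_nonneg_bounded[OF defect_nonneg])
  fix N
  define B where "B = suminf htail"
  define Z where "Z = (\<Sum>n. 1 / real n ^ 2)"
  let ?P = "primes_upto N"
  have B0: "B \<ge> 0" unfolding B_def by (intro suminf_nonneg summable_htail htail_nonneg)
  have "l \<le> (\<Prod>p\<in>?P. norm (rat 0 p))" using l[of N] by (simp add: rat_prod_def prod_norm)
  also have "\<dots> \<le> (\<Prod>p\<in>?P. exp (- (1 - norm (rat 0 p))))"
    using exp_ge_add_one_self[of "norm (rat 0 p) - 1" for p] by (intro prod_mono) auto
  also have "\<dots> = exp (- (\<Sum>p\<in>?P. 1 - norm (rat 0 p)))" by (simp add: exp_sum[symmetric] sum_negf[symmetric])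
  finally have "ln l \<le> - (\<Sum>p\<in>?P. 1 - norm (rat 0 p))" 
    using assms(1) ln_le_cancel_iff[of l "exp (- (\<Sum>p\<in>?P. 1 - norm (rat 0 p)))"] by simp
  hence 1: "(\<Sum>p\<in>?P. 1 - norm (rat 0 p)) \<le> - ln l" by simp
  have T: "(\<Sum>p\<in>?P. htail p) \<le> B"
    unfolding B_def by (intro sum_le_suminf summable_htail htail_nonneg) auto
  have Z: "(\<Sum>p\<in>?P. 1 / real p ^ 2) \<le> Z" unfolding Z_def
    using inverse_power_summable[of 2, where 'a = real] by (intro sum_le_suminf) (auto simp: inverse_eq_divide)
  have "(\<Sum>n<N. defect n) \<le> (\<Sum>n\<le>N. defect n)" using defect_nonneg by (intro sum_mono2) auto
  also have "\<dots> = (\<Sum>p\<in>?P. defect p)"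
    by (rule sum.mono_neutral_right) (auto simp: primes_upto_def defect_def)
  also have "\<dots> \<le> (\<Sum>p\<in>?P. (1 + \<beta> + B) * ((1 - norm (rat 0 p)) + 4 * \<beta>\<^sup>2 * (1 / real p ^ 2) + 4 * B * htail p) + 2 * htail p)"
    unfolding B_def by (intro sum_mono defect_le) (auto simp: primes_upto_def)
  also have "\<dots> = (1 + \<beta> + B) * ((\<Sum>p\<in>?P. 1 - norm (rat 0 p)) + 4 * \<beta>\<^sup>2 * (\<Sum>p\<in>?P. 1 / real p ^ 2) + 4 * B * (\<Sum>p\<in>?P. htail p)) + 2 * (\<Sum>p\<in>?P. htail p)"
    by (simp only: sum.distrib sum_distrib_left[symmetric])
  also have "\<dots> \<le> (1 + \<beta> + B) * (- ln l + 4 * \<beta>\<^sup>2 * Z + 4 * B * B) + 2 * B"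
    using 1 Z T B0 \<beta>_nonneg by (intro add_mono mult_left_mono) auto
  finally show "(\<Sum>n<N. defect n) \<le> (1 + \<beta> + B) * (- ln l + 4 * \<beta>\<^sup>2 * Z + 4 * B * B) + 2 * B" .
qed

end

subsection \<open>The Tauberian argument\<close>

text \<open>For u = n^(-1/L) with L = ln x, u \<ge> 1/e means n \<le> x, and u \<le> exp (-1 -
  \<epsilon>) means n \<ge> x^(1 + \<epsilon>). A continuous function interpolates between the two
  ranges and is approximated by Stone-Weierstrass. The third bound controls the transition
  range.\<close>

lemma karamata_polynomial:
  fixes \<epsilon> :: real
  assumes "\<epsilon> > 0"
  obtains a :: "nat \<Rightarrow> real" and m :: nat where
    "\<And>u. exp (- 1) \<le> u \<Longrightarrow> u \<le> 1 \<Longrightarrow> \<bar>1 / u - (\<Sum>i\<le>m. a i * u ^ i)\<bar> \<le> \<epsilon>"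
    "\<And>u. 0 \<le> u \<Longrightarrow> u \<le> exp (- 1 - \<epsilon>) \<Longrightarrow> \<bar>\<Sum>i\<le>m. a i * u ^ i\<bar> \<le> \<epsilon>"
    "\<And>u. 0 < u \<Longrightarrow> u \<le> 1 \<Longrightarrow> u * \<bar>\<Sum>i\<le>m. a i * u ^ i\<bar> \<le> 1 + \<epsilon> * u"
proof -
  define b c where "b = exp (- 1 :: real)" and "c = exp (- 1 - \<epsilon>)"
  define ramp where "ramp u = min 1 (max 0 ((u - c) / (b - c)))" for u
  \<comment> \<open>The maximum leaves 1/u unchanged for u \<ge> 1/e and keeps the denominator away
    from 0.\<close>
  define \<psi> where "\<psi> u = ramp u / max u b" for u
  have bc: "0 < c" "c < b" using assms by (auto simp: b_def c_def)
  have "continuous_on {0..1} \<psi>"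
    unfolding \<psi>_def ramp_def using bc by (intro continuous_intros) auto
  then obtain Q where Q: "real_polynomial_function Q" "\<And>u. u \<in> {0..1} \<Longrightarrow> \<bar>\<psi> u - Q u\<bar> < \<epsilon>"
    using Stone_Weierstrass_real_polynomial_function[of "{0..1::real}" \<psi> \<epsilon>] assms by auto
  obtain a m where am: "Q = (\<lambda>x. \<Sum>i\<le>m. a i * x ^ i)"
    using Q(1) unfolding real_polynomial_function_iff_sum by auto
  show ?thesis
  proof (rule that[of a m])
    fix u :: real assume u: "exp (- 1) \<le> u" "u \<le> 1"
    have "ramp u = 1" using u bc by (simp add: ramp_def b_def)
    moreover have "max u b = u" using u by (simp add: b_def)
    moreover have "u \<in> {0..1}" using u order.trans[OF exp_ge_zero u(1)] by simp
    ultimately show "\<bar>1 / u - (\<Sum>i\<le>m. a i * u ^ i)\<bar> \<le> \<epsilon>"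
      using Q(2)[of u] by (simp add: \<psi>_def am)
  next
    fix u :: real assume u: "0 \<le> u" "u \<le> exp (- 1 - \<epsilon>)"
    have "ramp u = 0" using u bc by (simp add: ramp_def c_def divide_nonpos_pos)
    moreover have "u \<in> {0..1}" using u assms order.trans[of u "exp (- 1 - \<epsilon>)" 1] by simp
    ultimately show "\<bar>\<Sum>i\<le>m. a i * u ^ i\<bar> \<le> \<epsilon>"
      using Q(2)[of u] by (simp add: \<psi>_def am)
  next
    fix u :: real assume u: "0 < u" "u \<le> 1"
    have "0 \<le> ramp u" "ramp u \<le> 1" by (auto simp: ramp_def)
    hence "0 \<le> \<psi> u" "u * \<psi> u \<le> 1"
      using u bc mult_mono[of u "max u b" "ramp u" 1] by (auto simp: \<psi>_def divide_le_eq)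
    moreover have "u * \<bar>Q u\<bar> \<le> u * (\<psi> u + \<epsilon>)"
      using Q(2)[of u] u \<open>0 \<le> \<psi> u\<close> by (intro mult_left_mono) auto
    ultimately show "u * \<bar>\<Sum>i\<le>m. a i * u ^ i\<bar> \<le> 1 + \<epsilon> * u"
      by (simp add: am algebra_simps)
  qed
qed

lemma primes_upto_floor: "x \<ge> 0 \<Longrightarrow> {p. prime p \<and> real p \<le> x} = primes_upto (nat \<lfloor>x\<rfloor>)"
  by (auto simp: primes_upto_def le_nat_iff le_floor_iff)

section \<open>F_h/F_g when the products stay away from 0\<close>

context dominated_mult
begin

text \<open>For factors in the unit disc, products differ by at most the sum of the differences of
  their factors. Primes up to a fixed \<open>y\<close> are handled by continuity at \<sigma> = 0.
  For larger primes the difference is at most \<eta> times a term of bounded sum plus a term of the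
  convergent series of \<open>\<tau>\<close>.\<close>

lemma dser_rat_limit_nonvanishing:
  assumes "c > 0" and summ: "summable defect"
  shows "((\<lambda>x. dser_rat (c / ln x) - rat_prod (nat \<lfloor>x\<rfloor>)) \<longlongrightarrow> 0) at_top"
proof (rule tendstoI)
  fix e :: real assume e: "e > 0"
  \<comment> \<open>The bound that \<open>pp_dirichlet\<close> yields for the sum of
    \<open>\<zeta>\<close> below, applied with the exponents 1/L and c/L.\<close>
  define K2 where "K2 = (1 + \<beta>) * (8 * C * exp 1 * c) + 8 * C / c"
  have K2: "K2 \<ge> 0" using \<beta>_nonneg C_nonneg assms by (simp add: K2_def)
  define \<eta> where "\<eta> = e / (4 * (K2 + 1))"
  have \<eta>: "\<eta> > 0" using e K2 by (simp add: \<eta>_def)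
  have \<eta>K2: "\<eta> * K2 \<le> e / 4"
    using e K2 by (simp add: \<eta>_def divide_le_eq mult_left_mono)
  \<comment> \<open>The coefficients of \<open>defect p\<close> for primes up to x and beyond x,
    added. Likewise \<open>K + 2\<close> in \<open>\<tau>\<close> adds the two coefficients of
    \<open>htail p\<close>.\<close>
  define A where "A = ((1 + \<beta>) * c + 1) / (2 * \<eta>)"
  have A: "A \<ge> 0" using \<beta>_nonneg assms \<eta> by (simp add: A_def)
  define \<tau> where "\<tau> n = A * defect n + (K + 2) * htail n" for n
  have "summable \<tau>" unfolding \<tau>_def[abs_def] by (intro summable_add summable_mult summ summable_htail)
  moreover have "\<tau> n \<ge> 0" for n using A K_nonneg defect_nonneg htail_nonneg by (simp add: \<tau>_def)
  moreover have "e / 4 > 0" using e by simp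
  ultimately obtain y where y: "\<And>S. finite S \<Longrightarrow> S \<subseteq> {y<..} \<Longrightarrow> sum \<tau> S < e / 4"
    using summable_tail_small[of \<tau> "e / 4"] by auto
  have "((\<lambda>\<sigma>. \<Sum>p\<in>primes_upto y. norm (rat \<sigma> p - rat 0 p)) \<longlongrightarrow> (\<Sum>p\<in>primes_upto y. norm (rat 0 p - rat 0 p))) (at_right 0)"
    by (intro tendsto_intros rat_tendsto_0) (auto simp: primes_upto_def)
  hence "\<forall>\<^sub>F \<sigma> in at_right 0. (\<Sum>p\<in>primes_upto y. norm (rat \<sigma> p - rat 0 p)) < e / 4"
    by (rule order_tendstoD) (use e in auto)
  hence "\<forall>\<^sub>F x in at_top. (\<Sum>p\<in>primes_upto y. norm (rat (c / ln x) p - rat 0 p)) < e / 4"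
    using filterlim_div_ln[OF assms(1)] by (rule eventually_compose_filterlim)
  thus "\<forall>\<^sub>F x in at_top. dist (dser_rat (c / ln x) - rat_prod (nat \<lfloor>x\<rfloor>)) 0 < e"
    using eventually_ge_at_top[of "real y"] eventually_ge_at_top[of "exp (max 1 c)"]
  proof eventually_elim
    case (elim x)
    define L \<sigma> X where "L = ln x" and "\<sigma> = c / L" and "X = nat \<lfloor>x\<rfloor>"
    have x0: "x > 0" using elim(3) exp_gt_zero[of "max 1 c"] by linarith
    \<comment> \<open>Puts both 1/L and c/L into the range (0, 1] of
      \<open>pp_dirichlet\<close>.\<close>
    have "L \<ge> max 1 c" unfolding L_def by (subst ln_ge_iff[OF x0]) (rule elim(3))
    hence L: "L \<ge> 1" "L \<ge> c" by auto
    have \<sigma>: "\<sigma> > 0" "\<sigma> \<le> 1" using L assms by (auto simp: \<sigma>_def)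
    have X: "p \<le> X \<longleftrightarrow> real p \<le> x" for p using x0 by (simp add: X_def le_nat_iff le_floor_iff)
    have yX: "y \<le> X" using elim(2) X by simp
    \<comment> \<open>Padding with 1 beyond x makes P(x) a product over the same primes as the
      longer Euler product.\<close>
    define b where "b p = (if p \<le> X then rat 0 p else 1)" for p
    define w where "w s p = g p * ln (real p) / real p * real p powr (- s)" for s p
    \<comment> \<open>The first summand serves the primes up to x, where e p^(-1/L) \<ge> 1; the
      second serves those beyond x, where ln p \<ge> L.\<close>
    define \<zeta> where "\<zeta> p = (1 + \<beta>) * \<sigma> * exp 1 * w (1 / L) p + w \<sigma> p / L" for p
    have term_le: "norm (rat \<sigma> p - b p) \<le> \<eta> * \<zeta> p + \<tau> p" if p: "prime p" for p
    proof -
      define d where "d = norm (complex_of_real (g p) - h p) / real p"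
      have p1: "p \<ge> 1" "real p \<ge> 1" using prime_ge_1_nat[OF p] by auto
      have lnp: "ln (real p) \<ge> 0" using p1 by simp
      have w0: "w s p \<ge> 0" for s using g_nonneg lnp by (simp add: w_def)
      have "d \<le> (\<eta> * g p + (g p - Re (h p)) / (2 * \<eta>)) / real p"
        unfolding d_def by (intro divide_right_mono norm_g_minus_h_le p1 \<eta>) auto
      hence d: "d \<le> \<eta> * (g p / real p) + defect p / (2 * \<eta>)"
        using p by (simp add: defect_def add_divide_distrib mult_ac)
      have A_eq: "A * defect p = (1 + \<beta>) * (defect p / (2 * \<eta>)) * c + defect p / (2 * \<eta>)"
      proof -
        have "A * defect p = ((1 + \<beta>) * c + 1) * (defect p / (2 * \<eta>))" by (simp add: A_def)
        thus ?thesis by (simp only: distrib_right mult_1 mult_ac)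
      qed
      note nn = defect_nonneg[of p] htail_nonneg[of p] \<beta>_nonneg K_nonneg \<eta> g_nonneg[of p]
      show ?thesis
      proof (cases "p \<le> X")
        case True
        hence px: "real p \<le> x" using X by simp
        have s: "0 \<le> \<sigma> * ln (real p)" "\<sigma> * ln (real p) \<le> c"
        proof -
          have "ln (real p) \<le> L" using px p1 by (simp add: L_def)
          hence "\<sigma> * ln (real p) \<le> \<sigma> * L" using \<sigma> by (intro mult_left_mono) auto
          thus "\<sigma> * ln (real p) \<le> c" using L by (simp add: \<sigma>_def)
        qed (use lnp \<sigma> in auto)
        have "norm (rat \<sigma> p - b p) \<le> (1 + \<beta>) * d * (\<sigma> * ln (real p)) + K * htail p"
          using norm_rat_diff_le[OF p, of \<sigma>] \<sigma> True by (simp add: b_def d_def)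
        also have "(1 + \<beta>) * d * (\<sigma> * ln (real p)) \<le>
            (1 + \<beta>) * (\<eta> * (g p / real p) + defect p / (2 * \<eta>)) * (\<sigma> * ln (real p))"
          using d s nn by (intro mult_right_mono mult_left_mono) auto
        also have "\<dots> = \<eta> * ((1 + \<beta>) * \<sigma> * (g p * ln (real p) / real p)) + (1 + \<beta>) * (defect p / (2 * \<eta>)) * (\<sigma> * ln (real p))"
          by (simp add: algebra_simps)
        also have "\<dots> \<le> \<eta> * ((1 + \<beta>) * \<sigma> * (exp 1 * w (1 / L) p)) + (1 + \<beta>) * (defect p / (2 * \<eta>)) * c"
        proof (intro add_mono mult_left_mono)
          have "exp 1 * real p powr (- (1 / L)) \<ge> 1"
          proof -
            have "exp (- 1) \<le> real p powr (- (1 / L))"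
              using px p1 L by (simp add: powr_def L_def divide_le_eq)
            hence "exp 1 * exp (- 1) \<le> exp 1 * real p powr (- (1 / L))" by (intro mult_left_mono) auto
            thus ?thesis by (simp add: exp_add[symmetric])
          qed
          hence "g p * ln (real p) / real p * 1 \<le> g p * ln (real p) / real p * (exp 1 * real p powr (- (1 / L)))"
            using nn lnp by (intro mult_left_mono) auto
          thus "g p * ln (real p) / real p \<le> exp 1 * w (1 / L) p" by (simp add: w_def mult_ac)
        qed (use nn \<sigma> s in auto)
        also have "\<dots> + K * htail p \<le> \<eta> * \<zeta> p + \<tau> p"
        proof -
          have "(1 + \<beta>) * (defect p / (2 * \<eta>)) * c \<le> A * defect p"
            using nn by (simp add: A_eq)
          moreover have "K * htail p \<le> (K + 2) * htail p" using nn by (intro mult_right_mono) auto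
          moreover have "\<eta> * (w \<sigma> p / L) \<ge> 0" using nn w0[of \<sigma>] L by simp
          ultimately show ?thesis by (simp add: \<zeta>_def \<tau>_def algebra_simps)
        qed
        finally show ?thesis by simp
      next
        case False
        hence px: "real p > x" using X[of p] by simp
        have pw: "0 \<le> real p powr (- \<sigma>)" "real p powr (- \<sigma>) \<le> 1"
          using p1 \<sigma> by (auto simp: powr_minus_divide divide_le_eq ge_one_powr_ge_zero)
        have "norm (rat \<sigma> p - b p) \<le> d * real p powr (- \<sigma>) + 2 * htail p"
          using norm_one_minus_rat_le[OF p, of \<sigma>] \<sigma> False by (simp add: b_def d_def norm_minus_commute)
        also have "d * real p powr (- \<sigma>) \<le> (\<eta> * (g p / real p) + defect p / (2 * \<eta>)) * real p powr (- \<sigma>)"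
          using d pw by (intro mult_right_mono) auto
        also have "\<dots> = \<eta> * (g p / real p * real p powr (- \<sigma>)) + defect p / (2 * \<eta>) * real p powr (- \<sigma>)"
          by (simp add: algebra_simps)
        also have "\<dots> \<le> \<eta> * (w \<sigma> p / L) + defect p / (2 * \<eta>) * 1"
        proof (intro add_mono mult_left_mono)
          have "L \<le> ln (real p)" using px x0 by (simp add: L_def)
          hence "g p / real p * real p powr (- \<sigma>) * L \<le> g p / real p * real p powr (- \<sigma>) * ln (real p)"
            using nn by (intro mult_left_mono) auto
          thus "g p / real p * real p powr (- \<sigma>) \<le> w \<sigma> p / L"
            using L by (subst pos_le_divide_eq) (auto simp: w_def mult_ac)
        qed (use nn pw in auto)
        also have "\<dots> + 2 * htail p \<le> \<eta> * \<zeta> p + \<tau> p"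
        proof -
          have "defect p / (2 * \<eta>) \<le> A * defect p"
            using nn assms by (simp add: A_eq)
          moreover have "2 * htail p \<le> (K + 2) * htail p" using nn by (intro mult_right_mono) auto
          moreover have "\<eta> * ((1 + \<beta>) * \<sigma> * exp 1 * w (1 / L) p) \<ge> 0" using nn w0[of "1 / L"] \<sigma> by simp
          ultimately show ?thesis by (simp add: \<zeta>_def \<tau>_def algebra_simps)
        qed
        finally show ?thesis by simp
      qed
    qed
    have "norm ((\<Prod>p\<in>primes_upto N. rat \<sigma> p) - rat_prod X) \<le> 3 / 4 * e" if N: "N \<ge> X" for N
    proof -
      let ?S = "primes_upto N - primes_upto y"
      have P: "prime p" if "p \<in> primes_upto N" for p using that by (simp add: primes_upto_def)
      have sub: "primes_upto y \<subseteq> primes_upto N" using yX N by (auto simp: primes_upto_def)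
      have "rat_prod X = (\<Prod>p\<in>primes_upto X. b p)"
        unfolding rat_prod_def by (rule prod.cong) (auto simp: b_def primes_upto_def)
      also have "\<dots> = (\<Prod>p\<in>primes_upto N. b p)"
        by (rule prod.mono_neutral_left) (use N in \<open>auto simp: b_def primes_upto_def\<close>)
      finally have "norm ((\<Prod>p\<in>primes_upto N. rat \<sigma> p) - rat_prod X) \<le> (\<Sum>p\<in>primes_upto N. norm (rat \<sigma> p - b p))"
        using P \<sigma> by (auto intro!: norm_prod_diff norm_rat_le_1 simp: b_def)
      also have "\<dots> = (\<Sum>p\<in>?S. norm (rat \<sigma> p - b p)) + (\<Sum>p\<in>primes_upto y. norm (rat \<sigma> p - b p))"
        by (rule sum.subset_diff[OF sub]) simp
      also have "(\<Sum>p\<in>primes_upto y. norm (rat \<sigma> p - b p)) = (\<Sum>p\<in>primes_upto y. norm (rat \<sigma> p - rat 0 p))"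
        by (rule sum.cong) (use yX in \<open>auto simp: b_def primes_upto_def\<close>)
      also have "\<dots> \<le> e / 4" using elim(1) by (simp add: \<sigma>_def L_def)
      also have "(\<Sum>p\<in>?S. norm (rat \<sigma> p - b p)) \<le> (\<Sum>p\<in>?S. \<eta> * \<zeta> p + \<tau> p)"
        using P by (intro sum_mono term_le) auto
      also have "\<dots> = \<eta> * (\<Sum>p\<in>?S. \<zeta> p) + sum \<tau> ?S"
        by (simp add: sum.distrib sum_distrib_left)
      also have "sum \<tau> ?S \<le> e / 4"
        by (rule less_imp_le, rule y) (auto simp: primes_upto_def)
      also have "\<eta> * (\<Sum>p\<in>?S. \<zeta> p) \<le> e / 4"
      proof -
        have ws: "(\<Sum>p\<in>?S. w s p) \<le> 8 * C / s" if "0 < s" "s \<le> 1" for s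
          unfolding w_def using that P by (intro pp_dirichlet) auto
        have "(\<Sum>p\<in>?S. \<zeta> p) = (1 + \<beta>) * \<sigma> * exp 1 * (\<Sum>p\<in>?S. w (1 / L) p) + (\<Sum>p\<in>?S. w \<sigma> p) / L"
          by (simp add: \<zeta>_def sum.distrib sum_distrib_left sum_divide_distrib)
        also have "\<dots> \<le> (1 + \<beta>) * \<sigma> * exp 1 * (8 * C / (1 / L)) + 8 * C / \<sigma> / L"
          using \<beta>_nonneg \<sigma> L by (intro add_mono mult_left_mono divide_right_mono ws) auto
        also have "\<dots> = K2" using L assms by (simp add: K2_def \<sigma>_def)
        finally have "\<eta> * (\<Sum>p\<in>?S. \<zeta> p) \<le> \<eta> * K2" using \<eta> by (intro mult_left_mono) auto
        thus ?thesis using \<eta>K2 by simp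
      qed
      finally show ?thesis by simp
    qed
    hence "norm (dser_rat \<sigma> - rat_prod X) \<le> 3 / 4 * e"
      by (intro Lim_norm_ubound[OF _ tendsto_diff[OF dser_rat_euler[OF \<sigma>(1)] tendsto_const]])
         (auto simp: eventually_sequentially)
    thus ?case using e by (simp add: \<sigma>_def L_def X_def)
  qed
qed

text \<open>The two cases are exhaustive: the norms of the partial products have a positive lower
  bound or become arbitrarily small.\<close>

lemma dser_rat_limit:
  assumes "c > 0"
  shows "((\<lambda>x. dser_rat (c / ln x) - rat_prod (nat \<lfloor>x\<rfloor>)) \<longlongrightarrow> 0) at_top"
proof (cases "\<exists>l>0. \<forall>N. norm (rat_prod N) \<ge> l")
  case True
  thus ?thesis using summable_defect dser_rat_limit_nonvanishing[OF assms] by blast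
next
  case False
  thus ?thesis by (intro dser_rat_limit_vanishing assms) (meson not_le)
qed

end

section \<open>Karamata's method\<close>

context chebyshev_mult
begin

lemma log_sum_g_ge_1: "x \<ge> 1 \<Longrightarrow> log_sum g x \<ge> 1"
proof -
  assume x: "x \<ge> 1"
  have "(\<Sum>n\<in>{1}. g n / of_nat n) \<le> log_sum g x"
    unfolding log_sum_def using x g_nonneg by (intro sum_mono2) auto
  thus ?thesis using g_mult by (simp add: multiplicative_1)
qed

text \<open>The combination of the values F_f((i + 1)/L) is the sum of (f(n)/n) u Q(u) with u =
  n^(-1/L). By \<open>Q1\<close> and \<open>Q2\<close> it differs termwise from the truncated sum by
  at most \<epsilon> u g(n)/n, except in the transition range, which \<open>short_log_sum_le\<close>
  controls.\<close>

lemma log_sum_approx: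
  fixes f :: "nat \<Rightarrow> 'a :: {real_normed_field, banach}"
  assumes f: "dominated f" and x: "ln x \<ge> 1" "x > 0" and \<epsilon>: "0 < \<epsilon>" "\<epsilon> \<le> 1"
    and Q1: "\<And>u. exp (- 1) \<le> u \<Longrightarrow> u \<le> 1 \<Longrightarrow> \<bar>1 / u - (\<Sum>i\<le>m. a i * u ^ i)\<bar> \<le> \<epsilon>"
    and Q2: "\<And>u. 0 \<le> u \<Longrightarrow> u \<le> exp (- 1 - \<epsilon>) \<Longrightarrow> \<bar>\<Sum>i\<le>m. a i * u ^ i\<bar> \<le> \<epsilon>"
    and Q3: "\<And>u. 0 < u \<Longrightarrow> u \<le> 1 \<Longrightarrow> u * \<bar>\<Sum>i\<le>m. a i * u ^ i\<bar> \<le> 1 + \<epsilon> * u"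
  shows "norm (log_sum f x - (\<Sum>i\<le>m. of_real (a i) * dser f (real (Suc i) / ln x))) \<le>
           (\<epsilon> + 4 * C * exp 2 * (\<epsilon> + 1 / ln x)) * dser g (1 / ln x)"
proof -
  define L where "L = ln x"
  have L: "L \<ge> 1" using x by (simp add: L_def)
  define u where "u n = real n powr (- (1 / L))" for n :: nat
  define Q where "Q v = (\<Sum>i\<le>m. a i * v ^ i)" for v
  let ?S = "{n. 1 \<le> n \<and> real n \<le> x}" and ?W = "{n. x < real n \<and> real n \<le> x powr (1 + \<epsilon>)}"
  let ?A = "\<lambda>n. if n \<in> ?S then f n / of_nat n else 0"
  let ?B = "\<lambda>n. dterm f (1 / L) n * of_real (Q (u n))"
  \<comment> \<open>A summable majorant of the termwise error, valid in all three ranges of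
    n.\<close>
  let ?M = "\<lambda>n. \<epsilon> * dterm g (1 / L) n + (if n \<in> ?W then g n / real n else 0)"
  have A: "?A sums log_sum f x"
    unfolding log_sum_def by (rule sums_If_finite_set) simp
  \<comment> \<open>The factor u already present in the term at 1/L turns u^i into u^(i + 1); hence
    the arguments start at 1/L.\<close>
  have "dterm f (1 / L) n * of_real (u n) ^ i = dterm f (real (Suc i) / L) n" for n i
  proof (cases "n = 0")
    case False
    have "real n powr (- (1 / L)) * (real n powr (- (1 / L))) ^ i = real n powr (- (real (Suc i) / L))"
      using False by (simp add: powr_power powr_add[symmetric] add_divide_distrib mult_ac)
    hence "of_real (real n powr (- (1 / L))) * of_real (real n powr (- (1 / L))) ^ i = (of_real (real n powr (- (real (Suc i) / L))) :: 'a)"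
      by (metis of_real_mult of_real_power)
    thus ?thesis by (simp add: dterm_def u_def mult.assoc)
  qed auto
  hence "?B n = (\<Sum>i\<le>m. of_real (a i) * dterm f (real (Suc i) / L) n)" for n
    by (simp add: Q_def sum_distrib_left mult_ac)
  moreover have "(\<lambda>n. \<Sum>i\<le>m. of_real (a i) * dterm f (real (Suc i) / L) n) sums (\<Sum>i\<le>m. of_real (a i) * dser f (real (Suc i) / L))"
    unfolding dser_def using L
    by (intro sums_sum sums_mult summable_sums summable_norm_cancel[OF summable_norm_dterm[OF f]]) auto
  ultimately have B: "?B sums (\<Sum>i\<le>m. of_real (a i) * dser f (real (Suc i) / L))"
    by simp
  have M: "?M sums (\<epsilon> * dser g (1 / L) + (\<Sum>n\<in>?W. g n / real n))"
    unfolding dser_def using L by (intro sums_add sums_mult summable_sums summable_dterm_g sums_If_finite_set) auto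
  have le: "norm (?A n - ?B n) \<le> ?M n" for n
  proof (cases "n = 0")
    case False
    have n1: "real n \<ge> 1" using False by simp
    have un: "u n = exp (- (ln (real n) / L))" using False by (simp add: u_def powr_def)
    have u: "0 < u n" "u n \<le> 1" using n1 L by (auto simp: un)
    have fn: "norm (f n) \<le> g n" using f n1 by (simp add: dominated_def)
    have df: "dterm f (1 / L) n = f n / of_nat n * of_real (u n)" and dg: "dterm g (1 / L) n = g n / real n * u n"
      by (simp_all add: dterm_def u_def)
    have nB: "norm (?B n) = norm (f n) / real n * (u n * \<bar>Q (u n)\<bar>)"
      using u by (simp add: df norm_mult norm_divide)
    consider "real n \<le> x" | "x < real n" "real n \<le> x powr (1 + \<epsilon>)" | "x powr (1 + \<epsilon>) < real n" "x < real n"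
      by linarith
    thus ?thesis
    proof cases
      case 1
      have "ln (real n) \<le> L" using 1 n1 by (simp add: L_def)
      hence "exp (- 1) \<le> u n" using L by (simp add: un divide_le_eq)
      hence q: "\<bar>1 / u n - Q (u n)\<bar> \<le> \<epsilon>" using Q1 u by (simp add: Q_def)
      have "?A n - ?B n = f n / of_nat n * of_real (u n) * of_real (1 / u n - Q (u n))"
        using 1 False u by (simp add: df algebra_simps)
      hence "norm (?A n - ?B n) = norm (f n) / real n * u n * \<bar>1 / u n - Q (u n)\<bar>"
        using u by (simp only: norm_mult norm_divide norm_of_real norm_of_nat abs_of_pos)
      also have "\<dots> \<le> g n / real n * u n * \<epsilon>"
        using q fn u g_nonneg[of n] by (intro mult_mono divide_right_mono) auto
      finally show ?thesis using 1 by (simp add: dg mult_ac)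
    next
      case 2
      have "norm (?A n - ?B n) = norm (f n) / real n * (u n * \<bar>Q (u n)\<bar>)"
        using 2 nB by simp
      also have "\<dots> \<le> g n / real n * (1 + \<epsilon> * u n)"
        using Q3[OF u] fn u g_nonneg[of n] by (intro mult_mono divide_right_mono) (auto simp: Q_def)
      finally show ?thesis using 2 by (simp add: dg algebra_simps)
    next
      case 3
      have "(1 + \<epsilon>) * L = ln (x powr (1 + \<epsilon>))" using x by (simp add: L_def ln_powr)
      also have "\<dots> \<le> ln (real n)" using 3 x n1 by (subst ln_le_cancel_iff) auto
      finally have "u n \<le> exp (- 1 - \<epsilon>)" using L by (simp add: un le_divide_eq algebra_simps)
      hence q: "\<bar>Q (u n)\<bar> \<le> \<epsilon>" using Q2[of "u n"] u by (simp add: Q_def)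
      have "norm (?A n - ?B n) = norm (f n) / real n * (u n * \<bar>Q (u n)\<bar>)"
        using 3 nB by simp
      also have "\<dots> \<le> g n / real n * (u n * \<epsilon>)"
        using q fn u g_nonneg[of n] by (intro mult_mono divide_right_mono mult_left_mono) auto
      finally show ?thesis using 3 by (simp add: dg mult_ac)
    qed
  qed (use x in simp)
  have D: "(\<lambda>n. ?A n - ?B n) sums (log_sum f x - (\<Sum>i\<le>m. of_real (a i) * dser f (real (Suc i) / L)))"
    by (rule sums_diff[OF A B])
  have sn: "summable (\<lambda>n. norm (?A n - ?B n))"
    by (rule summable_comparison_test'[OF sums_summable[OF M], where N = 0]) (use le in simp)
  have "norm (log_sum f x - (\<Sum>i\<le>m. of_real (a i) * dser f (real (Suc i) / L))) \<le> (\<Sum>n. norm (?A n - ?B n))"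
    using summable_norm[OF sn] sums_unique[OF D] by simp
  also have "\<dots> \<le> \<epsilon> * dser g (1 / L) + (\<Sum>n\<in>?W. g n / real n)"
    using sums_le[OF le summable_sums[OF sn] M] .
  also have "(\<Sum>n\<in>?W. g n / real n) \<le> 4 * C * exp 2 * (\<epsilon> + 1 / L) * dser g (1 / L)"
    using short_log_sum_le[of x \<epsilon>] x \<epsilon> by (simp add: L_def)
  finally show ?thesis by (simp add: L_def algebra_simps)
qed

end

section \<open>Comparison of H(x) with P(x) G(x)\<close>

context dominated_mult
begin

text \<open>The same polynomial approximates H and G, which costs the approximation error twice
  because |P| \<le> 1. What remains are the differences F_h - P F_g at the points (i + 1)/L, where
  F_g is at most its value at 1/L.\<close>

lemma log_sum_diff_le:
  assumes x: "ln x \<ge> 1" "x > 0" and \<epsilon>: "0 < \<epsilon>" "\<epsilon> \<le> 1"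
    and Q: "\<And>u. exp (- 1) \<le> u \<Longrightarrow> u \<le> 1 \<Longrightarrow> \<bar>1 / u - (\<Sum>i\<le>m. a i * u ^ i)\<bar> \<le> \<epsilon>"
      "\<And>u. 0 \<le> u \<Longrightarrow> u \<le> exp (- 1 - \<epsilon>) \<Longrightarrow> \<bar>\<Sum>i\<le>m. a i * u ^ i\<bar> \<le> \<epsilon>"
      "\<And>u. 0 < u \<Longrightarrow> u \<le> 1 \<Longrightarrow> u * \<bar>\<Sum>i\<le>m. a i * u ^ i\<bar> \<le> 1 + \<epsilon> * u"
    and P: "norm P \<le> 1"
  shows "norm (log_sum h x - P * complex_of_real (log_sum g x)) \<le>
     (2 * (\<epsilon> + 4 * C * exp 2 * (\<epsilon> + 1 / ln x)) + (\<Sum>i\<le>m. \<bar>a i\<bar> * norm (dser_rat (real (Suc i) / ln x) - P))) * dser g (1 / ln x)"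
proof -
  define s where "s i = real (Suc i) / ln x" for i
  define Th where "Th = (\<Sum>i\<le>m. complex_of_real (a i) * dser h (s i))"
  define Tg where "Tg = (\<Sum>i\<le>m. a i * dser g (s i))"
  define B where "B = (\<epsilon> + 4 * C * exp 2 * (\<epsilon> + 1 / ln x)) * dser g (1 / ln x)"
  have s: "s i > 0" "s i \<ge> 1 / ln x" for i 
    using x less_le_trans[OF zero_less_one x(1)] by (auto simp: s_def intro!: divide_right_mono)
  have Bh: "norm (log_sum h x - Th) \<le> B"
    unfolding Th_def B_def s_def by (rule log_sum_approx[OF dominated_h x \<epsilon> Q])
  have "norm (log_sum g x - Tg) \<le> B"
    using log_sum_approx[OF dominated_g x \<epsilon> Q] by (simp add: Tg_def B_def s_def)
  hence "norm (complex_of_real (log_sum g x - Tg)) \<le> B" by (simp only: norm_of_real real_norm_def)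
  hence Bg: "norm (P * complex_of_real (log_sum g x - Tg)) \<le> B"
    using mult_mono[OF P, of _ B] P by (simp add: norm_mult del: of_real_diff)
  have "Th - P * complex_of_real Tg = (\<Sum>i\<le>m. complex_of_real (a i) * ((dser_rat (s i) - P) * complex_of_real (dser g (s i))))"
  proof -
    have "dser h (s i) = dser_rat (s i) * complex_of_real (dser g (s i))" for i
      using dser_g_ge[OF s(1)[of i]] by (simp add: dser_rat_def)
    thus ?thesis by (simp add: Th_def Tg_def sum_distrib_left sum_subtractf algebra_simps)
  qed
  also have "norm \<dots> \<le> (\<Sum>i\<le>m. \<bar>a i\<bar> * norm (dser_rat (s i) - P) * dser g (1 / ln x))"
  proof (rule sum_norm_le)
    fix i
    have "norm (complex_of_real (a i) * ((dser_rat (s i) - P) * complex_of_real (dser g (s i)))) = \<bar>a i\<bar> * norm (dser_rat (s i) - P) * dser g (s i)"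
      using dser_g_ge[OF s(1)[of i]] by (simp add: norm_mult)
    also have "\<dots> \<le> \<bar>a i\<bar> * norm (dser_rat (s i) - P) * dser g (1 / ln x)"
      using less_le_trans[OF zero_less_one x(1)] s[of i]
      by (intro mult_left_mono dser_g_mono) (auto simp del: ln_gt_zero_iff)
    finally show "norm (complex_of_real (a i) * ((dser_rat (s i) - P) * complex_of_real (dser g (s i)))) \<le> \<bar>a i\<bar> * norm (dser_rat (s i) - P) * dser g (1 / ln x)" .
  qed
  finally have T: "norm (Th - P * complex_of_real Tg) \<le> (\<Sum>i\<le>m. \<bar>a i\<bar> * norm (dser_rat (s i) - P)) * dser g (1 / ln x)"
    by (simp add: sum_distrib_right)
  have "log_sum h x - P * complex_of_real (log_sum g x) = (log_sum h x - Th) + (Th - P * complex_of_real Tg) - P * complex_of_real (log_sum g x - Tg)"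
    by (simp add: algebra_simps)
  hence "norm (log_sum h x - P * complex_of_real (log_sum g x)) \<le> B + (\<Sum>i\<le>m. \<bar>a i\<bar> * norm (dser_rat (s i) - P)) * dser g (1 / ln x) + B"
    using norm_triangle_mono[OF Bh T] Bg norm_triangle_ineq4 by (smt (verit, best))
  thus ?thesis by (simp add: B_def s_def algebra_simps)
qed

text \<open>All errors in \<open>log_sum_diff_le\<close> are relative to F_g(1 / ln x), and
  \<open>log_sum_g_lower\<close> allows this to be replaced by G(x) / c.\<close>

lemma log_sum_ratio_limit:
  "((\<lambda>x. log_sum h x / complex_of_real (log_sum g x) - rat_prod (nat \<lfloor>x\<rfloor>)) \<longlongrightarrow> 0) at_top"
proof (rule tendstoI)
  fix e :: real assume e: "e > 0"
  obtain c where c: "c > 0" "\<forall>\<^sub>F x in at_top. c * dser g (1 / ln x) \<le> log_sum g x"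
    by (rule log_sum_g_lower)
  \<comment> \<open>For fixed \<epsilon> the error \<open>err x\<close> below tends to
    \<open>\<epsilon> * K3\<close>; the choice of \<epsilon> makes this at most half of
    \<open>c * e\<close>.\<close>
  define K3 where "K3 = 2 * (1 + 4 * C * exp 2)"
  have K3: "K3 > 0" using C_nonneg by (simp add: K3_def add_pos_nonneg)
  define \<epsilon> where "\<epsilon> = min 1 (c * e / (2 * K3))"
  have \<epsilon>: "0 < \<epsilon>" "\<epsilon> \<le> 1" using c e K3 by (auto simp: \<epsilon>_def)
  have "\<epsilon> * K3 \<le> c * e / (2 * K3) * K3" using K3 by (intro mult_right_mono) (auto simp: \<epsilon>_def)
  also have "\<dots> < c * e" using c e K3 by simp
  finally have \<epsilon>K: "\<epsilon> * K3 < c * e" .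
  \<comment> \<open>The polynomial depends on \<epsilon> alone and is fixed before x grows, so its
    finitely many coefficients do not affect the limit of \<open>err\<close>.\<close>
  obtain a m where Q:
    "\<And>u. exp (- 1) \<le> u \<Longrightarrow> u \<le> 1 \<Longrightarrow> \<bar>1 / u - (\<Sum>i\<le>m. a i * u ^ i)\<bar> \<le> \<epsilon>"
    "\<And>u. 0 \<le> u \<Longrightarrow> u \<le> exp (- 1 - \<epsilon>) \<Longrightarrow> \<bar>\<Sum>i\<le>m. a i * u ^ i\<bar> \<le> \<epsilon>"
    "\<And>u. 0 < u \<Longrightarrow> u \<le> 1 \<Longrightarrow> u * \<bar>\<Sum>i\<le>m. a i * u ^ i\<bar> \<le> 1 + \<epsilon> * u"
    using karamata_polynomial[OF \<epsilon>(1)] by blast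
  define err where "err x = 2 * (\<epsilon> + 4 * C * exp 2 * (\<epsilon> + 1 / ln x)) +
    (\<Sum>i\<le>m. \<bar>a i\<bar> * norm (dser_rat (real (Suc i) / ln x) - rat_prod (nat \<lfloor>x\<rfloor>)))" for x
  have "(err \<longlongrightarrow> 2 * (\<epsilon> + 4 * C * exp 2 * (\<epsilon> + 0)) + (\<Sum>i\<le>m. \<bar>a i\<bar> * norm (0 :: complex))) at_top"
    unfolding err_def
    by (intro tendsto_intros dser_rat_limit tendsto_divide_0[OF tendsto_const]
          filterlim_at_top_imp_at_infinity ln_at_top) auto
  moreover have "2 * (\<epsilon> + 4 * C * exp 2 * (\<epsilon> + 0)) + (\<Sum>i\<le>m. \<bar>a i\<bar> * norm (0 :: complex)) < c * e"
    using \<epsilon>K by (simp add: K3_def algebra_simps)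
  ultimately have "\<forall>\<^sub>F x in at_top. err x < c * e" by (rule order_tendstoD)
  thus "\<forall>\<^sub>F x in at_top. dist (log_sum h x / complex_of_real (log_sum g x) - rat_prod (nat \<lfloor>x\<rfloor>)) 0 < e"
    using c(2) eventually_ge_at_top[of "exp 1"]
  proof eventually_elim
    case (elim x)
    have x0: "x > 0" using elim(3) exp_gt_zero[of "1::real"] by linarith
    have L: "ln x \<ge> 1" using elim(3) x0 by (simp add: ln_ge_iff)
    let ?G = "log_sum g x" and ?P = "rat_prod (nat \<lfloor>x\<rfloor>)"
    have D: "dser g (1 / ln x) \<ge> 1" using L by (intro dser_g_ge) auto
    have G: "?G > 0" using elim(2) D c(1) by (smt (verit) mult_pos_pos)
    have "norm (log_sum h x - ?P * complex_of_real ?G) \<le> err x * dser g (1 / ln x)"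
      unfolding err_def by (rule log_sum_diff_le[OF L x0 \<epsilon> Q norm_rat_prod_le_1])
    also have "\<dots> < c * e * dser g (1 / ln x)" using elim(1) D by (intro mult_strict_right_mono) auto
    also have "\<dots> = e * (c * dser g (1 / ln x))" by simp
    also have "\<dots> \<le> e * ?G" using elim(2) e by (intro mult_left_mono) auto
    finally have "norm (log_sum h x - ?P * complex_of_real ?G) < e * ?G" .
    moreover have "log_sum h x / complex_of_real ?G - ?P = (log_sum h x - ?P * complex_of_real ?G) / complex_of_real ?G"
      using G by (simp add: field_simps)
    ultimately show ?case using G by (simp add: norm_divide divide_less_eq)
  qed
qed

end

theorem theorem1:
  fixes g :: "nat \<Rightarrow> real" and h :: "nat \<Rightarrow> complex"
  assumes g_mult: "multiplicative g"
    and g_nonneg: "\<And>n. g n \<ge> 0"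
    and g_prime_bdd: "\<exists>\<beta>. \<forall>p. prime p \<longrightarrow> g p \<le> \<beta>"
    and g_higher_pp: "(\<lambda>q. g q / real q) summable_on {q. \<exists>p k. prime p \<and> k \<ge> 2 \<and> q = p ^ k}"
    and g_chebyshev: "\<exists>C. \<forall>y::real. y \<ge> 2 \<longrightarrow>
            \<bar>(1 / y) * (\<Sum>q | primepow q \<and> real q \<le> y. g q * ln (real q))\<bar> \<le> C"
    and h_mult: "multiplicative h"
    and h_bdd: "\<And>n. n \<ge> 1 \<Longrightarrow> norm (h n) \<le> g n"
  shows "\<exists>e :: real \<Rightarrow> complex. (e \<longlongrightarrow> 0) at_top \<and>
           (\<forall>\<^sub>F x in at_top.
              (\<Sum>n | 1 \<le> n \<and> real n \<le> x. h n / of_nat n) =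
              ((\<Prod>p | prime p \<and> real p \<le> x.
                  (\<Sum>k. h (p ^ k) / of_nat (p ^ k)) *
                  inverse (complex_of_real (\<Sum>k. g (p ^ k) / real (p ^ k)))) + e x)
              * complex_of_real (\<Sum>n | 1 \<le> n \<and> real n \<le> x. g n / real n))"
proof -
  obtain \<beta> where \<beta>: "\<And>p. prime p \<Longrightarrow> g p \<le> \<beta>" using g_prime_bdd by blast
  obtain C where C: "\<And>y::real. y \<ge> 2 \<Longrightarrow>
      \<bar>(1 / y) * (\<Sum>q | primepow q \<and> real q \<le> y. g q * ln (real q))\<bar> \<le> C"
    using g_chebyshev by blast
  interpret dominated_mult g \<beta> C h
  proof
    fix y :: real assume y: "y \<ge> 2"
    have "(1 / y) * (\<Sum>q | primepow q \<and> real q \<le> y. g q * ln (real q)) \<le> C"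
      using C[OF y] by linarith
    thus "(\<Sum>q | primepow q \<and> real q \<le> y. g q * ln (real q)) \<le> C * y"
      using y by (simp add: divide_le_eq)
  qed (use assms \<beta> in auto)
  \<comment> \<open>The asserted equation forces this choice of error; since G(x) \<ge> 1 for x
    \<ge> 1, the division is legitimate.\<close>
  let ?e = "\<lambda>x. log_sum h x / complex_of_real (log_sum g x) - rat_prod (nat \<lfloor>x\<rfloor>)"
  show ?thesis
  proof (intro exI[of _ ?e] conjI log_sum_ratio_limit)
    show "\<forall>\<^sub>F x in at_top.
              (\<Sum>n | 1 \<le> n \<and> real n \<le> x. h n / of_nat n) =
              ((\<Prod>p | prime p \<and> real p \<le> x.
                  (\<Sum>k. h (p ^ k) / of_nat (p ^ k)) *
                  inverse (complex_of_real (\<Sum>k. g (p ^ k) / real (p ^ k)))) + ?e x)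
              * complex_of_real (\<Sum>n | 1 \<le> n \<and> real n \<le> x. g n / real n)"
      using eventually_ge_at_top[of 1]
    proof eventually_elim
      case (elim x)
      have prod: "(\<Prod>p | prime p \<and> real p \<le> x.
                  (\<Sum>k. h (p ^ k) / of_nat (p ^ k)) *
                  inverse (complex_of_real (\<Sum>k. g (p ^ k) / real (p ^ k)))) = rat_prod (nat \<lfloor>x\<rfloor>)"
        using elim by (simp only: primes_upto_floor rat_prod_def rat_def efac_def dterm_zero_exponent divide_inverse)
      have H: "(\<Sum>n | 1 \<le> n \<and> real n \<le> x. h n / of_nat n) = log_sum h x"
        and G: "(\<Sum>n | 1 \<le> n \<and> real n \<le> x. g n / real n) = log_sum g x"
        by (simp_all add: log_sum_def)
      show ?case unfolding prod H G using log_sum_g_ge_1[OF elim] by simp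
    qed
  qed
qed

end
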